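(* Let $f\in L^2_{\rm loc}([0,\infty);L^2(\Omega)^3)$ and suppose there is a constant $\alpha\ge 0$ such that $\|f\|_{L^2([n-1,n];L^2(\Omega)^3)}\le\alpha$ for all $n\in\mathbb N$. Let $\tau=1/T_1$ with $T_1\in\mathbb N$, let $h>0$, and set $$R_0(\Omega,f):=\frac{1}{1-e^{-A^{-2}}}\Big(\frac{1-e^{-2A^{-2}}}{2A^{-2}}\Big)^{1/2}\alpha .$$ Let $R\ge R_0(\Omega,f)$ and $\tilde U_R:=\{\tilde u:\Omega_h\to\mathbb R^3 \mid \|\tilde u\|_{\Omega_h}\le R,\ \tilde u|_{\partial\Omega_h}=0\}$. Then, for each $\tilde u^0\in\tilde U_R$, the discrete Navier-Stokes equations (see context) with initial datum $\tilde u^0$ are solvable for all $n\in\mathbb N$, and the solution satisfies $\tilde u^{mT_1}\in\tilde U_R$ for all $m\in\mathbb N$.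
   Context: $\Omega\subset\mathbb R^3$ is a bounded connected open set with Lipschitz boundary; $e^1,e^2,e^3$ is the standard basis of $\mathbb R^3$. Grid: for $h>0$ and $B\subset h\mathbb Z^3$, $\partial B:=\{x\in B\mid \{x\pm he^i\}_{i=1,2,3}\not\subset B\}$. $C_r(x):=\prod_{i=1}^3[x_i-\frac r2,x_i+\frac r2]$ and $\Omega_h:=\{x\in\Omega\cap h\mathbb Z^3\mid C_{4h}(x)\subset\Omega\}$. Functions on $\Omega_h$ are extended by $0$ outside $\Omega_h$, and $D_i^+\phi(x)=\frac{\phi(x+he^i)-\phi(x)}{h}$, $D_i\phi(x)=\frac{\phi(x+he^i)-\phi(x-he^i)}{2h}$, $D_i^2\phi(x)=\frac{\phi(x+he^i)+\phi(x-he^i)-2\phi(x)}{h^2}$, $\mathcal D\phi=(D_1\phi,D_2\phi,D_3\phi)$, $\mathcal D\cdot w=\sum_iD_iw_i$. Norm: $\|u\|_{\Omega_h}=(\sum_{x\in\Omega_h}|u(x)|^2h^3)^{1/2}$. $h\mathbb Z^3$ is partitioned into the eight parity classes $G^1,\dots,G^8$ (points $hz$, $z\in\mathbb Z^3$, according to the parities of $z_1,z_2,z_3$). $\Omega_h^\circ:=\{x\in\Omega_h\setminus\partial\Omega_h\mid x+a^1he^1+a^2he^2+a^3he^3\in\Omega_h\setminus\partial\Omega_h \text{ for all } a^1,a^2,a^3\in\{0,1,2\}\}$, $\Omega_h^{\circ j}:=\Omega_h^\circ\cap G^j$. Standing assumption: $h$ is small enough that each $\Omega_h^{\circ j}$ is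 connected (any two of its points are joined by a path inside $\Omega_h^{\circ j}$ with steps in $\{\pm2he^i\}$). Discrete Helmholtz-Hodge decomposition: for each $u:\Omega_h\to\mathbb R^3$ there are $w:\Omega_h\to\mathbb R^3$ and $\phi:\Omega_h\to\mathbb R$ with $\mathcal D\cdot w=0$ on $\Omega_h$, $w+\mathcal D\phi=u$ on $\Omega_h\setminus\partial\Omega_h$, $w=0$ on $\partial\Omega_h$, $\sum_{x\in\Omega_h^{\circ j}}\phi(x)=0$ ($j=1,\dots,8$); $w$ is uniquely determined and $P_hu:=w$. Discrete Navier-Stokes equations: with $f^n(x):=\tau^{-1}h^{-3}\int_{\tau n}^{\tau(n+1)}\int_{C_h(x)}f(t,y)\,dy\,dt$ and given $\tilde u^0:\Omega_h\to\mathbb R^3$, put $u^0=P_h\tilde u^0$ and for $n\ge0$ $$\frac{\tilde u^{n+1}(x)-u^n(x)}{\tau}=-\frac12\sum_{j=1}^3\Big(u^n_j(x-he^j)D_j\tilde u^{n+1}(x-he^j)+u^n_j(x+he^j)D_j\tilde u^{n+1}(x+he^j)\Big)+\sum_{j=1}^3D_j^2\tilde u^{n+1}(x)+f^n(x)$$ for $x\in\Omega_h\setminus\partial\Omega_h$, $\tilde u^{n+1}=0$ on $\partial\Omega_h$, $u^{n+1}=P_h\tilde u^{n+1}$. $A>0$ is a constant depending only on the diameter of $\Omega$ such that $\sum_{x\in\Omega_h}|\phi(x)|^2\le A^2\sum_{x\in\Omega_h\setminus\partial\Omega_h}|D_i^+\phi(x)|^2$ for $i=1,2,3$ and every $\phi:\Omega_h\to\mathbb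 R$ with $\phi|_{\partial\Omega_h}=0$ (discrete Poincaré type inequality I). *)

theory Defs
  imports "HOL-Analysis.Analysis"
begin

text \<open>A Lipschitz function on a piece of the plane extends to the whole plane
  with the same Lipschitz constant, so \<open>g\<close> is taken to be globally defined.\<close>

definition lipschitz_boundary :: "(real^3) set \<Rightarrow> bool" where
  "lipschitz_boundary \<Omega> \<longleftrightarrow>
     (\<forall>p\<in>frontier \<Omega>. \<exists>r>0. \<exists>L. \<exists>Q :: real^3 \<Rightarrow> real^3. \<exists>g :: real \<times> real \<Rightarrow> real.
        orthogonal_transformation Q \<and> L-lipschitz_on UNIV g \<and>
        \<Omega> \<inter> ball p r = {x \<in> ball p r. Q x $ 3 < g (Q x $ 1, Q x $ 2)})"

definition lipschitz_domain :: "(real^3) set \<Rightarrow> bool" where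
  "lipschitz_domain \<Omega> \<longleftrightarrow> bounded \<Omega> \<and> connected \<Omega> \<and> open \<Omega> \<and> lipschitz_boundary \<Omega>"

abbreviation stdbasis :: "3 \<Rightarrow> real^3" where
  "stdbasis i \<equiv> axis i 1"

definition grid :: "real \<Rightarrow> (real^3) set" where
  "grid h = {x. \<exists>z :: int^3. x = (\<chi> i. h * of_int (z $ i))}"

definition grid_bdry :: "real \<Rightarrow> (real^3) set \<Rightarrow> (real^3) set" where
  "grid_bdry h B =
     {x \<in> B. \<not> (\<Union>i. {x + h *\<^sub>R stdbasis i, x - h *\<^sub>R stdbasis i}) \<subseteq> B}"

definition cube :: "real \<Rightarrow> real^3 \<Rightarrow> (real^3) set" where
  "cube r x = {y. \<forall>i. x $ i - r / 2 \<le> y $ i \<and> y $ i \<le> x $ i + r / 2}"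

definition grid_dom :: "(real^3) set \<Rightarrow> real \<Rightarrow> (real^3) set" where
  "grid_dom \<Omega> h = {x \<in> \<Omega> \<inter> grid h. cube (4 * h) x \<subseteq> \<Omega>}"

abbreviation dom_bdry :: "(real^3) set \<Rightarrow> real \<Rightarrow> (real^3) set" where
  "dom_bdry \<Omega> h \<equiv> grid_bdry h (grid_dom \<Omega> h)"

abbreviation dom_int :: "(real^3) set \<Rightarrow> real \<Rightarrow> (real^3) set" where
  "dom_int \<Omega> h \<equiv> grid_dom \<Omega> h - dom_bdry \<Omega> h"

text \<open>A function on \<open>grid_dom \<Omega> h\<close> is identified with its extension by zero.\<close>

definition grid_fun :: "(real^3) set \<Rightarrow> real \<Rightarrow> (real^3 \<Rightarrow> 'b::zero) set" where
  "grid_fun \<Omega> h = {u. \<forall>x. x \<notin> grid_dom \<Omega> h \<longrightarrow> u x = 0}"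

definition grid_norm :: "(real^3) set \<Rightarrow> real \<Rightarrow> (real^3 \<Rightarrow> real^3) \<Rightarrow> real" where
  "grid_norm \<Omega> h u = sqrt (\<Sum>x\<in>grid_dom \<Omega> h. (norm (u x))\<^sup>2 * h ^ 3)"

definition fwd_diff :: "real \<Rightarrow> 3 \<Rightarrow> (real^3 \<Rightarrow> 'b::real_vector) \<Rightarrow> real^3 \<Rightarrow> 'b" where
  "fwd_diff h i \<phi> x = (\<phi> (x + h *\<^sub>R stdbasis i) - \<phi> x) /\<^sub>R h"

definition ctr_diff :: "real \<Rightarrow> 3 \<Rightarrow> (real^3 \<Rightarrow> 'b::real_vector) \<Rightarrow> real^3 \<Rightarrow> 'b" where
  "ctr_diff h i \<phi> x = (\<phi> (x + h *\<^sub>R stdbasis i) - \<phi> (x - h *\<^sub>R stdbasis i)) /\<^sub>R (2 * h)"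

definition snd_diff :: "real \<Rightarrow> 3 \<Rightarrow> (real^3 \<Rightarrow> 'b::real_vector) \<Rightarrow> real^3 \<Rightarrow> 'b" where
  "snd_diff h i \<phi> x =
     (\<phi> (x + h *\<^sub>R stdbasis i) + \<phi> (x - h *\<^sub>R stdbasis i) - 2 *\<^sub>R \<phi> x) /\<^sub>R h\<^sup>2"

definition grid_grad :: "real \<Rightarrow> (real^3 \<Rightarrow> real) \<Rightarrow> real^3 \<Rightarrow> real^3" where
  "grid_grad h \<phi> x = (\<chi> i. ctr_diff h i \<phi> x)"

definition grid_div :: "real \<Rightarrow> (real^3 \<Rightarrow> real^3) \<Rightarrow> real^3 \<Rightarrow> real" where
  "grid_div h w x = (\<Sum>i\<in>UNIV. ctr_diff h i (\<lambda>y. w y $ i) x)"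

text \<open>The eight parity classes are indexed by \<open>p :: 3 \<Rightarrow> bool\<close>, where \<open>p i\<close> says that the
  \<open>i\<close>-th coordinate is an even multiple of \<open>h\<close>.\<close>

definition parity_class :: "real \<Rightarrow> (3 \<Rightarrow> bool) \<Rightarrow> (real^3) set" where
  "parity_class h p =
     {x. \<exists>z :: int^3. x = (\<chi> i. h * of_int (z $ i)) \<and> (\<forall>i. even (z $ i) \<longleftrightarrow> p i)}"

definition dom_core :: "(real^3) set \<Rightarrow> real \<Rightarrow> (real^3) set" where
  "dom_core \<Omega> h =
     {x \<in> dom_int \<Omega> h. \<forall>a :: 3 \<Rightarrow> nat. (\<forall>i. a i \<in> {0, 1, 2}) \<longrightarrow>
        x + (\<Sum>i\<in>UNIV. (real (a i) * h) *\<^sub>R stdbasis i) \<in> dom_int \<Omega> h}"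

definition dom_core_class :: "(real^3) set \<Rightarrow> real \<Rightarrow> (3 \<Rightarrow> bool) \<Rightarrow> (real^3) set" where
  "dom_core_class \<Omega> h p = dom_core \<Omega> h \<inter> parity_class h p"

definition step2_connected :: "real \<Rightarrow> (real^3) set \<Rightarrow> bool" where
  "step2_connected h S \<longleftrightarrow>
     (\<forall>x\<in>S. \<forall>y\<in>S. (x, y) \<in> {(a, b). a \<in> S \<and> b \<in> S \<and>
        (\<exists>i. b = a + (2 * h) *\<^sub>R stdbasis i \<or> b = a - (2 * h) *\<^sub>R stdbasis i)}\<^sup>*)"

definition admissible_mesh :: "(real^3) set \<Rightarrow> real \<Rightarrow> bool" where
  "admissible_mesh \<Omega> h \<longleftrightarrow> h > 0 \<and> (\<forall>p. step2_connected h (dom_core_class \<Omega> h p))"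

definition hh_decomp ::
  "(real^3) set \<Rightarrow> real \<Rightarrow> (real^3 \<Rightarrow> real^3) \<Rightarrow> (real^3 \<Rightarrow> real^3) \<Rightarrow> (real^3 \<Rightarrow> real) \<Rightarrow> bool" where
  "hh_decomp \<Omega> h u w \<phi> \<longleftrightarrow>
     w \<in> grid_fun \<Omega> h \<and> \<phi> \<in> grid_fun \<Omega> h \<and>
     (\<forall>x\<in>grid_dom \<Omega> h. grid_div h w x = 0) \<and>
     (\<forall>x\<in>dom_int \<Omega> h. w x + grid_grad h \<phi> x = u x) \<and>
     (\<forall>x\<in>dom_bdry \<Omega> h. w x = 0) \<and>
     (\<forall>p. (\<Sum>x\<in>dom_core_class \<Omega> h p. \<phi> x) = 0)"

definition hh_proj :: "(real^3) set \<Rightarrow> real \<Rightarrow> (real^3 \<Rightarrow> real^3) \<Rightarrow> real^3 \<Rightarrow> real^3" where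
  "hh_proj \<Omega> h u = (THE w. \<exists>\<phi>. hh_decomp \<Omega> h u w \<phi>)"

text \<open>\<open>L\<^sup>2\<close>-in-time functions with values in \<open>L\<^sup>2(\<Omega>)\<close> are represented by jointly Borel measurable
  functions of \<open>(t, y)\<close>; every class has such a representative, and the norms and cell averages
  below depend only on the class.\<close>

definition L2loc_L2 :: "(real^3) set \<Rightarrow> (real \<Rightarrow> real^3 \<Rightarrow> real^3) \<Rightarrow> bool" where
  "L2loc_L2 \<Omega> f \<longleftrightarrow>
     set_borel_measurable lborel ({0..} \<times> \<Omega>) (\<lambda>(t, y). f t y) \<and>
     (\<forall>T>0. set_integrable lborel ({0..T} \<times> \<Omega>) (\<lambda>(t, y). (norm (f t y))\<^sup>2))"

definition L2_L2_norm ::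
  "real \<Rightarrow> real \<Rightarrow> (real^3) set \<Rightarrow> (real \<Rightarrow> real^3 \<Rightarrow> real^3) \<Rightarrow> real" where
  "L2_L2_norm a b \<Omega> f =
     sqrt (LINT t:{a..b}|lborel. (LINT y:\<Omega>|lborel. (norm (f t y))\<^sup>2))"

definition cell_avg ::
  "real \<Rightarrow> real \<Rightarrow> (real \<Rightarrow> real^3 \<Rightarrow> real^3) \<Rightarrow> nat \<Rightarrow> real^3 \<Rightarrow> real^3" where
  "cell_avg h \<tau> f n x =
     (LINT t:{\<tau> * real n..\<tau> * (real n + 1)}|lborel. (LINT y:cube h x|lborel. f t y))
       /\<^sub>R (\<tau> * h ^ 3)"

text \<open>\<open>v n\<close> is the intermediate velocity (with tilde) at step \<open>n\<close>; the velocity itself is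
  \<open>hh_proj \<Omega> h (v n)\<close>.\<close>

definition dNS_solution ::
  "(real^3) set \<Rightarrow> real \<Rightarrow> real \<Rightarrow> (real \<Rightarrow> real^3 \<Rightarrow> real^3) \<Rightarrow> (real^3 \<Rightarrow> real^3) \<Rightarrow>
    (nat \<Rightarrow> real^3 \<Rightarrow> real^3) \<Rightarrow> bool" where
  "dNS_solution \<Omega> h \<tau> f v0 v \<longleftrightarrow>
     v 0 = v0 \<and> (\<forall>n. v n \<in> grid_fun \<Omega> h) \<and>
     (\<forall>n. let u = hh_proj \<Omega> h (v n) in
        (\<forall>x\<in>dom_int \<Omega> h.
           (v (Suc n) x - u x) /\<^sub>R \<tau> =
           - ((\<Sum>j\<in>UNIV.
                 (u (x - h *\<^sub>R stdbasis j) $ j) *\<^sub>R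
                    ctr_diff h j (v (Suc n)) (x - h *\<^sub>R stdbasis j)
               + (u (x + h *\<^sub>R stdbasis j) $ j) *\<^sub>R
                    ctr_diff h j (v (Suc n)) (x + h *\<^sub>R stdbasis j)) /\<^sub>R 2)
           + (\<Sum>j\<in>UNIV. snd_diff h j (v (Suc n)) x)
           + cell_avg h \<tau> f n x) \<and>
        (\<forall>x\<in>dom_bdry \<Omega> h. v (Suc n) x = 0))"

text \<open>The constant depends on the domain only through its diameter, so it is a function
  of the diameter that serves all domains and meshes.\<close>

definition poincare_const :: "(real \<Rightarrow> real) \<Rightarrow> bool" where
  "poincare_const A \<longleftrightarrow>
     (\<forall>\<Omega>. lipschitz_domain \<Omega> \<longrightarrow> A (diameter \<Omega>) > 0 \<and>
        (\<forall>h i. \<forall>\<phi> :: real^3 \<Rightarrow> real.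
           admissible_mesh \<Omega> h \<and> \<phi> \<in> grid_fun \<Omega> h \<and> (\<forall>x\<in>dom_bdry \<Omega> h. \<phi> x = 0) \<longrightarrow>
           (\<Sum>x\<in>grid_dom \<Omega> h. \<bar>\<phi> x\<bar>\<^sup>2)
             \<le> (A (diameter \<Omega>))\<^sup>2 * (\<Sum>x\<in>dom_int \<Omega> h. \<bar>fwd_diff h i \<phi> x\<bar>\<^sup>2)))"

definition R0 :: "real \<Rightarrow> real \<Rightarrow> real" where
  "R0 A \<alpha> =
     1 / (1 - exp (- (A powi (-2)))) *
     sqrt ((1 - exp (- 2 * A powi (-2))) / (2 * A powi (-2))) * \<alpha>"

definition U_ball :: "(real^3) set \<Rightarrow> real \<Rightarrow> real \<Rightarrow> (real^3 \<Rightarrow> real^3) set" where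
  "U_ball \<Omega> h R =
     {v \<in> grid_fun \<Omega> h. grid_norm \<Omega> h v \<le> R \<and> (\<forall>x\<in>dom_bdry \<Omega> h. v x = 0)}"

end

theory Submission
  imports Defs
begin

text \<open>
  Central differences are skew-adjoint for functions supported in the grid domain. Hence
  discrete gradients are orthogonal to divergence-free fields, so that \<open>hh_proj\<close> is an orthogonal
  projection, and the convection term is energy-neutral when the transporting field is
  divergence-free. The implicit step is therefore a linear system with a positive definite form,
  uniquely solvable. Applying the Poincare inequality in all three directions and testing
  with the solution gives, with \<open>a = A\<^sup>-\<^sup>2\<close>,
  \<open>(1 + 3 a \<tau>) \<parallel>v\<^sup>n\<^sup>+\<^sup>1\<parallel> \<le> \<parallel>v\<^sup>n\<parallel> + \<tau> \<parallel>f\<^sup>n\<parallel>\<close>. Iterating over one unit of time and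
  bounding the forcing by Cauchy-Schwarz yields \<open>\<parallel>v\<parallel> \<le> p R + sqrt ((1 - p\<^sup>2) / (6 a)) \<alpha>\<close> with
  \<open>p = (1 + 3 a \<tau>)\<^sup>-\<^sup>T \<le> 1 / (1 + 3 a)\<close>, where \<open>T = 1 / \<tau>\<close>. The factor 3 leaves enough room for this to be
  at most \<open>R\<close> uniformly in \<open>\<tau>\<close>, although \<open>(1 + a \<tau>)\<^sup>-\<^sup>T\<close> is larger than \<open>exp (- a)\<close>.
\<close>

subsection \<open>Linear algebra on finite families of functions\<close>

text \<open>Orthogonal projection of \<open>b\<close> onto the span of the \<open>g j\<close>, for
  the semi-inner product that sums over \<open>K\<close>. The induction is one Gram-Schmidt step:
  project both \<open>b\<close> and the new member onto the earlier ones, then remove from the first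
  residual its component along the second.\<close>

lemma finite_family_projection:
  fixes b :: "'a \<Rightarrow> 'b::real_inner" and g :: "'j \<Rightarrow> 'a \<Rightarrow> 'b"
  assumes "finite K" "finite J"
  shows "\<exists>c. \<forall>j\<in>J. (\<Sum>x\<in>K. (b x - (\<Sum>i\<in>J. c i *\<^sub>R g i x)) \<bullet> g j x) = 0"
  using assms(2)
proof (induction J arbitrary: b rule: finite_induct)
  case empty
  then show ?case by simp
next
  case (insert k J)
  define ip where "ip f f' = (\<Sum>x\<in>K. f x \<bullet> f' x)" for f f' :: "'a \<Rightarrow> 'b"
  have ip_diff: "ip (\<lambda>x. f x - s *\<^sub>R f' x) l = ip f l - s * ip f' l" for f f' l s
    by (simp add: ip_def inner_diff_left sum_subtractf sum_distrib_left)
  obtain c where c: "\<And>j. j \<in> J \<Longrightarrow> ip (\<lambda>x. b x - (\<Sum>i\<in>J. c i *\<^sub>R g i x)) (g j) = 0"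
    using insert.IH[of b] unfolding ip_def by blast
  obtain d where d: "\<And>j. j \<in> J \<Longrightarrow> ip (\<lambda>x. g k x - (\<Sum>i\<in>J. d i *\<^sub>R g i x)) (g j) = 0"
    using insert.IH[of "g k"] unfolding ip_def by blast
  define b' where "b' = (\<lambda>x. b x - (\<Sum>i\<in>J. c i *\<^sub>R g i x))"
  define g' where "g' = (\<lambda>x. g k x - (\<Sum>i\<in>J. d i *\<^sub>R g i x))"
  \<comment> \<open>If \<open>g k\<close> depends on the earlier members on \<open>K\<close>, then
    \<open>g'\<close> vanishes there, the quotient is 0 by convention, and any other value would
    serve as well.\<close>
  define t where "t = ip b' g' / ip g' g'"
  \<comment> \<open>\<open>g'\<close> and \<open>g k\<close> differ by a combination of the earlier
    members, which such an \<open>f\<close> does not see.\<close>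
  have ortho: "ip f g' = ip f (g k)" if "\<And>j. j \<in> J \<Longrightarrow> ip f (g j) = 0" for f
  proof -
    have "ip f g' = ip f (g k) - (\<Sum>x\<in>K. \<Sum>i\<in>J. d i * (f x \<bullet> g i x))"
      by (simp add: ip_def g'_def inner_diff_right inner_sum_right sum_subtractf)
    also have "(\<Sum>x\<in>K. \<Sum>i\<in>J. d i * (f x \<bullet> g i x)) = (\<Sum>i\<in>J. d i * ip f (g i))"
      by (subst sum.swap) (simp add: ip_def sum_distrib_left)
    also have "\<dots> = 0"
      using that by simp
    finally show ?thesis by simp
  qed
  have res_J: "ip (\<lambda>x. b' x - t *\<^sub>R g' x) (g j) = 0" if "j \<in> J" for j
    using c[OF that] d[OF that] by (simp add: ip_diff b'_def g'_def)
  have "ip (\<lambda>x. b' x - t *\<^sub>R g' x) g' = 0"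
  proof (cases "ip g' g' = 0")
    case True
    then have "\<forall>x\<in>K. g' x = 0"
      using assms(1) by (simp add: ip_def sum_nonneg_eq_0_iff)
    then show ?thesis by (simp add: ip_def)
  next
    case False
    then show ?thesis by (simp add: ip_diff t_def)
  qed
  then have res_k: "ip (\<lambda>x. b' x - t *\<^sub>R g' x) (g k) = 0"
    using ortho[of "\<lambda>x. b' x - t *\<^sub>R g' x"] res_J by simp
  \<comment> \<open>Coefficients of \<open>b' - t g'\<close> after expanding \<open>b'\<close> and
    \<open>g'\<close> in the original family.\<close>
  define e where "e i = (if i = k then t else c i - t * d i)" for i
  have "(\<Sum>i\<in>insert k J. e i *\<^sub>R g i x) = t *\<^sub>R g k x + (\<Sum>i\<in>J. (c i - t * d i) *\<^sub>R g i x)" for x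
    using insert.hyps by (auto simp: e_def intro!: sum.cong)
  then have res: "b x - (\<Sum>i\<in>insert k J. e i *\<^sub>R g i x) = b' x - t *\<^sub>R g' x" for x
    by (simp add: b'_def g'_def algebra_simps sum_subtractf scaleR_sum_right)
  have "ip (\<lambda>x. b x - (\<Sum>i\<in>insert k J. e i *\<^sub>R g i x)) (g j) = 0" if "j \<in> insert k J" for j
    unfolding res using that res_J res_k by blast
  then show ?case
    unfolding ip_def by blast
qed

text \<open>The functions supported in \<open>S\<close> are spanned by point masses with basis
  vectors as values, so projecting onto the range of \<open>T\<close> is projecting onto the
  finitely many images of these. It serves twice: for the discrete gradient in the Helmholtz-Hodge
  decomposition, and for the operator of a linear system.\<close>

lemma linear_image_projection:
  fixes T :: "('a \<Rightarrow> 'b::euclidean_space) \<Rightarrow> 'c \<Rightarrow> 'd::real_inner"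
  assumes "finite S" "finite K"
    and lin: "\<And>a f g x. T (\<lambda>y. a *\<^sub>R f y + g y) x = a *\<^sub>R T f x + T g x"
  obtains \<phi> where "\<And>x. x \<notin> S \<Longrightarrow> \<phi> x = 0"
    and "\<And>\<psi>. (\<And>x. x \<notin> S \<Longrightarrow> \<psi> x = 0) \<Longrightarrow> (\<Sum>x\<in>K. (b x - T \<phi> x) \<bullet> T \<psi> x) = 0"
proof -
  define \<delta> :: "'a \<times> 'b \<Rightarrow> 'a \<Rightarrow> 'b" where "\<delta> j = (\<lambda>x. if x = fst j then snd j else 0)" for j
  define J where "J = S \<times> (Basis :: 'b set)"
  have fin: "finite J"
    using assms(1) by (simp add: J_def)
  have T0: "T (\<lambda>y. 0) x = 0" for x
    using lin[of 0 "\<lambda>y. 0" "\<lambda>y. 0" x] lin[of 1 "\<lambda>y. 0" "\<lambda>y. 0" x] by simp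
  have Tsum: "T (\<lambda>y. \<Sum>j\<in>I. c j *\<^sub>R \<delta> j y) x = (\<Sum>j\<in>I. c j *\<^sub>R T (\<delta> j) x)" if "finite I" for I c x
    using that by induction (simp_all add: T0 lin)
  obtain c where c: "\<And>j. j \<in> J \<Longrightarrow>
      (\<Sum>x\<in>K. (b x - (\<Sum>i\<in>J. c i *\<^sub>R T (\<delta> i) x)) \<bullet> T (\<delta> j) x) = 0"
    using finite_family_projection[OF assms(2) fin, of b "\<lambda>j. T (\<delta> j)"] by blast
  define \<phi> where "\<phi> = (\<lambda>y. \<Sum>j\<in>J. c j *\<^sub>R \<delta> j y)"
  show ?thesis
  proof
    show "\<phi> x = 0" if "x \<notin> S" for x
      using that by (auto simp: \<phi>_def J_def \<delta>_def intro!: sum.neutral)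
    fix \<psi> :: "'a \<Rightarrow> 'b"
    assume \<psi>: "\<And>x. x \<notin> S \<Longrightarrow> \<psi> x = 0"
    have rep: "\<psi> x = (\<Sum>j\<in>J. (\<psi> (fst j) \<bullet> snd j) *\<^sub>R \<delta> j x)" for x
    proof -
      have "(\<Sum>j\<in>J. (\<psi> (fst j) \<bullet> snd j) *\<^sub>R \<delta> j x) = (\<Sum>y\<in>S. if x = y then \<psi> y else 0)"
        unfolding J_def sum.cartesian_product'
        by (intro sum.cong refl) (simp add: \<delta>_def euclidean_representation)
      then show ?thesis
        using assms(1) \<psi> by auto
    qed
    have "T \<psi> x = T (\<lambda>x. \<Sum>j\<in>J. (\<psi> (fst j) \<bullet> snd j) *\<^sub>R \<delta> j x) x" for x
      by (rule arg_cong[where f = "\<lambda>f. T f x"], rule ext, rule rep)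
    then have T\<psi>: "T \<psi> x = (\<Sum>j\<in>J. (\<psi> (fst j) \<bullet> snd j) *\<^sub>R T (\<delta> j) x)" for x
      unfolding Tsum[OF fin] .
    have "(\<Sum>x\<in>K. (b x - T \<phi> x) \<bullet> T \<psi> x)
        = (\<Sum>x\<in>K. \<Sum>j\<in>J. (\<psi> (fst j) \<bullet> snd j) * ((b x - T \<phi> x) \<bullet> T (\<delta> j) x))"
      unfolding T\<psi> by (simp add: inner_sum_right)
    also have "\<dots> = (\<Sum>j\<in>J. (\<psi> (fst j) \<bullet> snd j) * (\<Sum>x\<in>K. (b x - T \<phi> x) \<bullet> T (\<delta> j) x))"
      by (subst sum.swap) (simp add: sum_distrib_left)
    also have "\<dots> = 0"
      using c by (simp add: \<phi>_def Tsum[OF fin])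
    finally show "(\<Sum>x\<in>K. (b x - T \<phi> x) \<bullet> T \<psi> x) = 0" .
  qed
qed

text \<open>Definiteness kills the difference of two solutions, and it also kills the residual of
  the best approximate solution. Symmetry of \<open>T\<close> is not involved, which suits the skew
  convection term.\<close>

lemma definite_linear_solvable:
  fixes T :: "('a \<Rightarrow> 'b::euclidean_space) \<Rightarrow> 'a \<Rightarrow> 'b"
  assumes "finite K"
    and lin: "\<And>a f g x. T (\<lambda>y. a *\<^sub>R f y + g y) x = a *\<^sub>R T f x + T g x"
    and definite: "\<And>v. (\<And>x. x \<notin> K \<Longrightarrow> v x = 0) \<Longrightarrow> (\<Sum>x\<in>K. T v x \<bullet> v x) \<le> 0 \<Longrightarrow> v = (\<lambda>x. 0)"
  shows "\<exists>!v. (\<forall>x. x \<notin> K \<longrightarrow> v x = 0) \<and> (\<forall>x\<in>K. T v x = b x)"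
proof (rule ex_ex1I)
  obtain v where v: "\<And>x. x \<notin> K \<Longrightarrow> v x = 0"
    and ortho: "\<And>\<psi>. (\<And>x. x \<notin> K \<Longrightarrow> \<psi> x = 0) \<Longrightarrow> (\<Sum>x\<in>K. (b x - T v x) \<bullet> T \<psi> x) = 0"
    by (rule linear_image_projection[where T = T and b = b, OF assms(1) assms(1)])
      (rule lin, blast)
  \<comment> \<open>The residual \<open>\<rho>\<close> is orthogonal to the range of \<open>T\<close>, in particular to \<open>T \<rho>\<close>.\<close>
  define \<rho> where "\<rho> x = (if x \<in> K then b x - T v x else 0)" for x
  have "(\<Sum>x\<in>K. T \<rho> x \<bullet> \<rho> x) = (\<Sum>x\<in>K. (b x - T v x) \<bullet> T \<rho> x)"
    by (intro sum.cong refl) (simp add: \<rho>_def inner_commute)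
  also have "\<dots> = 0"
    by (rule ortho) (simp add: \<rho>_def)
  finally have "\<rho> = (\<lambda>x. 0)"
    by (intro definite) (auto simp: \<rho>_def)
  then have "T v x = b x" if "x \<in> K" for x
    using that by (auto simp: \<rho>_def fun_eq_iff split: if_splits)
  with v show "\<exists>v. (\<forall>x. x \<notin> K \<longrightarrow> v x = 0) \<and> (\<forall>x\<in>K. T v x = b x)"
    by blast
next
  fix v v'
  assume v: "(\<forall>x. x \<notin> K \<longrightarrow> v x = 0) \<and> (\<forall>x\<in>K. T v x = b x)"
    and v': "(\<forall>x. x \<notin> K \<longrightarrow> v' x = 0) \<and> (\<forall>x\<in>K. T v' x = b x)"
  have "T (\<lambda>y. (-1) *\<^sub>R v' y + v y) x = 0" if "x \<in> K" for x
    using v v' that lin[of "-1" v' v x] by simp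
  then have "(\<lambda>y. (-1) *\<^sub>R v' y + v y) = (\<lambda>x. 0)"
    by (intro definite) (use v v' in auto)
  then show "v = v'"
    by (auto simp: fun_eq_iff)
qed

subsection \<open>Summation by parts\<close>

text \<open>Zero extension reduces both sums to pairs of points of \<open>S\<close> that differ by
  \<open>e\<close>, and translation matches these pairs. All summation by parts below rests on this
  identity, applied with \<open>e\<close> and with \<open>- e\<close>.\<close>

lemma sum_shift_adjoint:
  fixes f g :: "'a::ab_group_add \<Rightarrow> 'b::real_inner"
  assumes "finite S" and "\<And>x. x \<notin> S \<Longrightarrow> f x = 0" and "\<And>x. x \<notin> S \<Longrightarrow> g x = 0"
  shows "(\<Sum>x\<in>S. f x \<bullet> g (x + e)) = (\<Sum>x\<in>S. f (x - e) \<bullet> g x)"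
proof -
  have "(\<Sum>x\<in>S. f x \<bullet> g (x + e)) = (\<Sum>x\<in>{x\<in>S. x + e \<in> S}. f x \<bullet> g (x + e))"
    using assms by (intro sum.mono_neutral_right) auto
  also have "\<dots> = (\<Sum>x\<in>{x\<in>S. x - e \<in> S}. f (x - e) \<bullet> g x)"
    by (rule sum.reindex_bij_witness[of _ "\<lambda>x. x - e" "\<lambda>x. x + e"]) auto
  also have "\<dots> = (\<Sum>x\<in>S. f (x - e) \<bullet> g x)"
    using assms by (intro sum.mono_neutral_left) auto
  finally show ?thesis .
qed

text \<open>Only an inequality, because the values at points of \<open>S\<close> that are not
  reached from \<open>S\<close> by the shift are missing on the left.\<close>

lemma sum_shift_le:
  fixes k :: "'a::ab_group_add \<Rightarrow> real"
  assumes "finite S" and "\<And>x. x \<notin> S \<Longrightarrow> k x = 0" and "\<And>x. k x \<ge> 0"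
  shows "(\<Sum>x\<in>S. k (x + e)) \<le> (\<Sum>x\<in>S. k x)"
proof -
  have "(\<Sum>x\<in>S. k (x + e)) = (\<Sum>x\<in>{x\<in>S. x + e \<in> S}. k (x + e))"
    using assms by (intro sum.mono_neutral_right) auto
  also have "\<dots> = (\<Sum>x\<in>{x\<in>S. x - e \<in> S}. k x)"
    by (rule sum.reindex_bij_witness[of _ "\<lambda>x. x - e" "\<lambda>x. x + e"]) auto
  also have "\<dots> \<le> (\<Sum>x\<in>S. k x)"
    using assms by (intro sum_mono2) auto
  finally show ?thesis .
qed

lemma ctr_diff_adjoint:
  fixes f g :: "real^3 \<Rightarrow> 'b::real_inner"
  assumes "finite S" and "\<And>x. x \<notin> S \<Longrightarrow> f x = 0" and "\<And>x. x \<notin> S \<Longrightarrow> g x = 0"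
  shows "(\<Sum>x\<in>S. f x \<bullet> ctr_diff h i g x) = - (\<Sum>x\<in>S. ctr_diff h i f x \<bullet> g x)"
proof -
  let ?e = "h *\<^sub>R stdbasis i"
  have *: "f x \<bullet> ctr_diff h i g x = (f x \<bullet> g (x + ?e) - f x \<bullet> g (x - ?e)) / (2 * h)"
    "ctr_diff h i f x \<bullet> g x = (f (x + ?e) \<bullet> g x - f (x - ?e) \<bullet> g x) / (2 * h)" for x
    by (simp_all add: ctr_diff_def inner_diff_left inner_diff_right divide_simps)
  show ?thesis
    unfolding * sum_divide_distrib[symmetric] sum_subtractf minus_divide_left minus_diff_eq
    using sum_shift_adjoint[of S f g ?e] sum_shift_adjoint[of S f g "- ?e"] assms
    by simp
qed

lemma grid_grad_div_adjoint:
  assumes "finite S" and "\<And>x. x \<notin> S \<Longrightarrow> w x = 0" and "\<And>x. x \<notin> S \<Longrightarrow> \<phi> x = 0"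
  shows "(\<Sum>x\<in>S. w x \<bullet> grid_grad h \<phi> x) = - (\<Sum>x\<in>S. grid_div h w x * \<phi> x)"
proof -
  have "(\<Sum>x\<in>S. w x \<bullet> grid_grad h \<phi> x) = (\<Sum>i\<in>UNIV. \<Sum>x\<in>S. (w x $ i) \<bullet> ctr_diff h i \<phi> x)"
    by (subst sum.swap) (simp add: inner_vec_def grid_grad_def)
  also have "\<dots> = (\<Sum>i\<in>UNIV. - (\<Sum>x\<in>S. ctr_diff h i (\<lambda>y. w y $ i) x \<bullet> \<phi> x))"
    using assms by (intro sum.cong refl ctr_diff_adjoint) auto
  also have "\<dots> = - (\<Sum>x\<in>S. grid_div h w x * \<phi> x)"
    by (simp add: sum_negf grid_div_def sum_distrib_right) (subst sum.swap, simp)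
  finally show ?thesis .
qed

text \<open>The sum in the scheme without its factor -1/2. It takes \<open>u_j D_j v\<close> at the
  two neighbours of \<open>x\<close>; after shifting the summation variable, \<open>D_j v\<close>
  meets \<open>v (x + h e_j) + v (x - h e_j)\<close>.\<close>

definition convection ::
  "real \<Rightarrow> (real^3 \<Rightarrow> real^3) \<Rightarrow> (real^3 \<Rightarrow> real^3) \<Rightarrow> real^3 \<Rightarrow> real^3" where
  "convection h u v x = (\<Sum>j\<in>UNIV.
       (u (x - h *\<^sub>R stdbasis j) $ j) *\<^sub>R ctr_diff h j v (x - h *\<^sub>R stdbasis j)
     + (u (x + h *\<^sub>R stdbasis j) $ j) *\<^sub>R ctr_diff h j v (x + h *\<^sub>R stdbasis j))"

text \<open>Moving the shifts onto the test function produces the central difference of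
  \<open>v\<close> times the sum of the two neighbouring values, a difference of squares, hence the
  central difference of \<open>v \<bullet> v\<close>. The total is \<open>u\<close> against a
  discrete gradient, which vanishes since \<open>u\<close> is divergence-free.\<close>

lemma convection_skew:
  fixes u v :: "real^3 \<Rightarrow> real^3"
  assumes "finite S" and u: "\<And>x. x \<notin> S \<Longrightarrow> u x = 0" and v: "\<And>x. x \<notin> S \<Longrightarrow> v x = 0"
    and div: "\<And>x. x \<in> S \<Longrightarrow> grid_div h u x = 0"
  shows "(\<Sum>x\<in>S. convection h u v x \<bullet> v x) = 0"
proof -
  define \<phi> where "\<phi> x = v x \<bullet> v x" for x
  have "(\<Sum>x\<in>S. (u (x - h *\<^sub>R stdbasis j) $ j) *\<^sub>R ctr_diff h j v (x - h *\<^sub>R stdbasis j) \<bullet> v x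
      + (u (x + h *\<^sub>R stdbasis j) $ j) *\<^sub>R ctr_diff h j v (x + h *\<^sub>R stdbasis j) \<bullet> v x)
    = (\<Sum>x\<in>S. u x $ j * ctr_diff h j \<phi> x)" for j
  proof -
    let ?e = "h *\<^sub>R stdbasis j"
    define g where "g x = (u x $ j) *\<^sub>R ctr_diff h j v x" for x
    have g: "g x = 0" if "x \<notin> S" for x
      using u[OF that] by (simp add: g_def)
    have "(\<Sum>x\<in>S. g (x - ?e) \<bullet> v x + g (x + ?e) \<bullet> v x) = (\<Sum>x\<in>S. g x \<bullet> (v (x + ?e) + v (x - ?e)))"
      using sum_shift_adjoint[OF assms(1), of g v ?e] sum_shift_adjoint[OF assms(1), of g v "- ?e"] g v
      by (simp add: sum.distrib inner_add_right)
    also have "\<dots> = (\<Sum>x\<in>S. u x $ j * ctr_diff h j \<phi> x)"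
      by (intro sum.cong refl)
        (simp add: g_def ctr_diff_def \<phi>_def inner_add_right inner_diff_left inner_diff_right
          inner_commute)
    finally show ?thesis by (simp add: g_def)
  qed
  then have "(\<Sum>x\<in>S. convection h u v x \<bullet> v x)
     = (\<Sum>j\<in>UNIV. \<Sum>x\<in>S. u x $ j * ctr_diff h j \<phi> x)"
    by (simp add: convection_def inner_sum_left inner_add_left) (subst sum.swap, simp)
  also have "\<dots> = (\<Sum>x\<in>S. u x \<bullet> grid_grad h \<phi> x)"
    by (subst sum.swap) (simp add: inner_vec_def grid_grad_def)
  also have "\<dots> = 0"
    using assms by (subst grid_grad_div_adjoint) (auto simp: \<phi>_def)
  finally show ?thesis .
qed

text \<open>Expanding both sides leaves the same mixed sum \<open>?c\<close>, so the claim reduces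
  to the shifted square sum being at most \<open>?n\<close>. The loss comes from forward differences
  based at points outside \<open>S\<close>, which are not counted.\<close>

lemma snd_diff_dissipative:
  fixes v :: "real^3 \<Rightarrow> 'b::real_inner"
  assumes "finite S" and v: "\<And>x. x \<notin> S \<Longrightarrow> v x = 0"
  shows "(\<Sum>x\<in>S. snd_diff h j v x \<bullet> v x) \<le> - (\<Sum>x\<in>S. (norm (fwd_diff h j v x))\<^sup>2)"
proof -
  let ?e = "h *\<^sub>R stdbasis j"
  let ?c = "\<Sum>x\<in>S. v x \<bullet> v (x + ?e)" and ?n = "\<Sum>x\<in>S. v x \<bullet> v x"
  have "(\<Sum>x\<in>S. v (x + ?e) \<bullet> v (x + ?e)) \<le> ?n"
    using assms by (intro sum_shift_le[where k = "\<lambda>x. v x \<bullet> v x"]) auto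
  moreover have "(\<Sum>x\<in>S. v (x - ?e) \<bullet> v x) = ?c"
    using sum_shift_adjoint[OF assms(1), of v v ?e] v by simp
  moreover have "(\<Sum>x\<in>S. (norm (fwd_diff h j v x))\<^sup>2)
      = ((\<Sum>x\<in>S. v (x + ?e) \<bullet> v (x + ?e)) - 2 * ?c + ?n) / h\<^sup>2"
  proof -
    have "(norm (fwd_diff h j v x))\<^sup>2
        = (v (x + ?e) \<bullet> v (x + ?e) - 2 * (v x \<bullet> v (x + ?e)) + v x \<bullet> v x) / h\<^sup>2" for x
      by (simp add: fwd_diff_def power_divide power2_norm_eq_inner inner_diff_left
          inner_diff_right inner_commute divide_inverse power_mult_distrib power_inverse)
    then show ?thesis
      by (simp add: sum.distrib sum_subtractf sum_distrib_left flip: sum_divide_distrib)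
  qed
  moreover have "(\<Sum>x\<in>S. snd_diff h j v x \<bullet> v x) = (?c + (\<Sum>x\<in>S. v (x - ?e) \<bullet> v x) - 2 * ?n) / h\<^sup>2"
  proof -
    have "snd_diff h j v x \<bullet> v x
        = (v x \<bullet> v (x + ?e) + v (x - ?e) \<bullet> v x - 2 * (v x \<bullet> v x)) / h\<^sup>2" for x
      by (simp add: snd_diff_def inner_diff_left inner_add_left inner_diff_right inner_add_right
          inner_commute divide_inverse)
    then show ?thesis
      by (simp add: sum.distrib sum_subtractf sum_distrib_left flip: sum_divide_distrib)
  qed
  ultimately show ?thesis
    by (simp only: minus_divide_left) (intro divide_right_mono, simp_all)
qed

subsection \<open>The discrete Helmholtz-Hodge projection\<close>

lemma finite_grid_dom:
  assumes "bounded \<Omega>" "h > 0"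
  shows "finite (grid_dom \<Omega> h)"
proof -
  obtain B where B: "\<And>x. x \<in> \<Omega> \<Longrightarrow> norm x \<le> B"
    using assms(1) by (auto simp: bounded_iff)
  define N where "N = \<lceil>B / h\<rceil>"
  have "grid_dom \<Omega> h \<subseteq> (\<lambda>z. \<chi> i. h * of_int (z i)) ` (UNIV \<rightarrow>\<^sub>E {-N..N})"
  proof
    fix x
    assume "x \<in> grid_dom \<Omega> h"
    then obtain z :: "int^3" where x: "x \<in> \<Omega>" "x = (\<chi> i. h * of_int (z $ i))"
      by (auto simp: grid_dom_def grid_def)
    have "z $ i \<in> {-N..N}" for i
    proof -
      have "\<bar>x $ i\<bar> \<le> B"
        using B[OF x(1)] component_le_norm_cart[of x i] by linarith
      then have "h * \<bar>of_int (z $ i)\<bar> \<le> B"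
        using assms(2) by (simp add: x(2) abs_mult)
      then have "\<bar>of_int (z $ i)\<bar> \<le> B / h"
        using assms(2) by (simp add: field_simps)
      then have "real_of_int \<bar>z $ i\<bar> \<le> of_int N"
        unfolding N_def using le_of_int_ceiling[of "B / h"] by linarith
      then have "\<bar>z $ i\<bar> \<le> N"
        by (simp only: of_int_le_iff)
      then show ?thesis by auto
    qed
    then show "x \<in> (\<lambda>z. \<chi> i. h * of_int (z i)) ` (UNIV \<rightarrow>\<^sub>E {-N..N})"
      by (intro image_eqI[of _ _ "\<lambda>i. z $ i"]) (auto simp: x(2))
  qed
  then show ?thesis
    by (rule finite_subset) (intro finite_imageI finite_PiE, simp_all)
qed

lemma dom_int_neighbours:
  assumes "x \<in> dom_int \<Omega> h"
  shows "x + h *\<^sub>R stdbasis i \<in> grid_dom \<Omega> h" "x - h *\<^sub>R stdbasis i \<in> grid_dom \<Omega> h"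
  using assms by (auto simp: grid_bdry_def)

text \<open>At a grid point the quotients are integers, so the floor only serves to make the class
  index a total function on space.\<close>

definition parity :: "real \<Rightarrow> real^3 \<Rightarrow> 3 \<Rightarrow> bool" where
  "parity h x = (\<lambda>i. even \<lfloor>x $ i / h\<rfloor>)"

lemma parity_of_class:
  assumes "x \<in> parity_class h p" "h \<noteq> 0"
  shows "parity h x = p"
  using assms by (auto simp: parity_class_def parity_def)

text \<open>The two points differ by \<open>2 * h\<close> in a single coordinate, so the floors
  differ by 0 or 2.\<close>

lemma parity_shift:
  assumes "h \<noteq> 0"
  shows "parity h (x + h *\<^sub>R stdbasis i) = parity h (x - h *\<^sub>R stdbasis i)"
proof -
  have "even \<lfloor>(x + h *\<^sub>R stdbasis i) $ j / h\<rfloor> \<longleftrightarrow> even \<lfloor>(x - h *\<^sub>R stdbasis i) $ j / h\<rfloor>" for j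
    using assms by (cases "i = j") (simp_all add: axis_def add_divide_distrib diff_divide_distrib)
  then show ?thesis
    by (simp only: parity_def)
qed

text \<open>Project \<open>u\<close>, restricted to the interior, onto discrete gradients. The
  residual, extended by zero, is \<open>w\<close>; being orthogonal to all gradients it is
  divergence-free by summation by parts.\<close>

lemma hh_decomp_exists:
  assumes fin: "finite (grid_dom \<Omega> h)" and "h \<noteq> 0"
  shows "\<exists>w \<phi>. hh_decomp \<Omega> h u w \<phi>"
proof -
  let ?S = "grid_dom \<Omega> h" and ?K = "dom_int \<Omega> h"
  have lin: "grid_grad h (\<lambda>y. a *\<^sub>R f y + g y) x = a *\<^sub>R grid_grad h f x + grid_grad h g x"
    for a f g x
    by (simp add: vec_eq_iff grid_grad_def ctr_diff_def algebra_simps)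
  obtain \<phi> where \<phi>: "\<And>x. x \<notin> ?S \<Longrightarrow> \<phi> x = 0"
    and ortho: "\<And>\<psi>. (\<And>x. x \<notin> ?S \<Longrightarrow> \<psi> x = 0) \<Longrightarrow>
      (\<Sum>x\<in>?K. (u x - grid_grad h \<phi> x) \<bullet> grid_grad h \<psi> x) = 0"
    by (rule linear_image_projection[where T = "grid_grad h" and b = u and S = ?S and K = ?K])
      (use fin lin in blast)+
  define w where "w x = (if x \<in> ?K then u x - grid_grad h \<phi> x else 0)" for x
  have "grid_div h w x = 0" if "x \<in> ?S" for x
  proof -
    \<comment> \<open>Testing the orthogonality with the divergence of \<open>w\<close> itself gives
      a vanishing sum of squares, at boundary points too.\<close>
    define \<psi> where "\<psi> x = (if x \<in> ?S then grid_div h w x else 0)" for x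
    have "(\<Sum>x\<in>?S. (grid_div h w x)\<^sup>2) = (\<Sum>x\<in>?S. grid_div h w x * \<psi> x)"
      by (intro sum.cong refl) (simp add: \<psi>_def power2_eq_square)
    also have "\<dots> = - (\<Sum>x\<in>?S. w x \<bullet> grid_grad h \<psi> x)"
      by (subst grid_grad_div_adjoint) (use fin in \<open>auto simp: w_def \<psi>_def\<close>)
    also have "(\<Sum>x\<in>?S. w x \<bullet> grid_grad h \<psi> x) = (\<Sum>x\<in>?K. w x \<bullet> grid_grad h \<psi> x)"
      using fin by (intro sum.mono_neutral_right) (auto simp: w_def)
    also have "\<dots> = 0"
      using ortho[of \<psi>] by (simp add: w_def \<psi>_def)
    finally show ?thesis
      using that fin by (simp add: sum_nonneg_eq_0_iff)
  qed
  moreover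
  \<comment> \<open>On \<open>dom_int \<Omega> h\<close> central differences see only one parity class, so subtracting a constant
    per class keeps the gradient and lets the class sums be normalized.\<close>
  define c where "c p = (\<Sum>x\<in>dom_core_class \<Omega> h p. \<phi> x) / card (dom_core_class \<Omega> h p)" for p
  define \<phi>' where "\<phi>' x = (if x \<in> ?S then \<phi> x - c (parity h x) else 0)" for x
  \<comment> \<open>Both neighbours of an interior point lie in the grid domain, so the cut-off in
    \<open>\<phi>'\<close> is not felt and the two subtracted constants coincide.\<close>
  have "grid_grad h \<phi>' x = grid_grad h \<phi> x" if "x \<in> ?K" for x
    using dom_int_neighbours[OF that] parity_shift[OF assms(2), of x]
    by (simp add: vec_eq_iff grid_grad_def ctr_diff_def \<phi>'_def)
  moreover have "(\<Sum>x\<in>dom_core_class \<Omega> h p. \<phi>' x) = 0" for p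
  proof -
    have sub: "dom_core_class \<Omega> h p \<subseteq> ?S"
      by (auto simp: dom_core_class_def dom_core_def)
    then have "(\<Sum>x\<in>dom_core_class \<Omega> h p. \<phi>' x) = (\<Sum>x\<in>dom_core_class \<Omega> h p. \<phi> x - c p)"
      using assms(2) by (intro sum.cong refl) (auto simp: \<phi>'_def dom_core_class_def parity_of_class)
    also have "\<dots> = 0"
      using finite_subset[OF sub fin] by (cases "dom_core_class \<Omega> h p = {}") (auto simp: sum_subtractf c_def)
    finally show ?thesis .
  qed
  ultimately have "hh_decomp \<Omega> h u w \<phi>'"
    unfolding hh_decomp_def by (auto simp: grid_fun_def w_def \<phi>'_def)
  then show ?thesis by blast
qed

lemma sum_grid_dom_eq_dom_int:
  assumes "finite (grid_dom \<Omega> h)" and "\<And>x. x \<notin> dom_int \<Omega> h \<Longrightarrow> k x = 0"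
  shows "(\<Sum>x\<in>grid_dom \<Omega> h. k x) = (\<Sum>x\<in>dom_int \<Omega> h. k x)"
  using assms by (intro sum.mono_neutral_right) auto

lemma div_free_ortho_grad:
  assumes "finite (grid_dom \<Omega> h)"
    and w: "\<And>x. x \<notin> dom_int \<Omega> h \<Longrightarrow> w x = 0" "\<And>x. x \<in> grid_dom \<Omega> h \<Longrightarrow> grid_div h w x = 0"
    and \<phi>: "\<And>x. x \<notin> grid_dom \<Omega> h \<Longrightarrow> \<phi> x = 0"
  shows "(\<Sum>x\<in>dom_int \<Omega> h. w x \<bullet> grid_grad h \<phi> x) = 0"
proof -
  have "(\<Sum>x\<in>dom_int \<Omega> h. w x \<bullet> grid_grad h \<phi> x) = (\<Sum>x\<in>grid_dom \<Omega> h. w x \<bullet> grid_grad h \<phi> x)"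
    using assms by (subst sum_grid_dom_eq_dom_int) auto
  also have "\<dots> = 0"
    using assms by (subst grid_grad_div_adjoint) auto
  finally show ?thesis .
qed

lemma hh_decomp_support:
  assumes "hh_decomp \<Omega> h u w \<phi>"
  shows "x \<notin> dom_int \<Omega> h \<Longrightarrow> w x = 0" "x \<notin> grid_dom \<Omega> h \<Longrightarrow> \<phi> x = 0"
  using assms by (auto simp: hh_decomp_def grid_fun_def)

text \<open>The difference of two candidates is a discrete gradient in the interior and also
  divergence-free, so it is orthogonal to itself.\<close>

lemma hh_decomp_unique:
  assumes fin: "finite (grid_dom \<Omega> h)"
    and d: "hh_decomp \<Omega> h u w \<phi>" "hh_decomp \<Omega> h u w' \<phi>'"
  shows "w = w'"
proof -
  let ?K = "dom_int \<Omega> h"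
  define z where "z x = w x - w' x" for x
  define \<psi> where "\<psi> x = \<phi>' x - \<phi> x" for x
  have z: "z x = grid_grad h \<psi> x" if "x \<in> ?K" for x
  proof -
    have "w x + grid_grad h \<phi> x = w' x + grid_grad h \<phi>' x"
      using d that by (simp add: hh_decomp_def)
    then have "w x = w' x + grid_grad h \<phi>' x - grid_grad h \<phi> x"
      by (simp only: eq_diff_eq)
    moreover have "grid_grad h \<psi> x = grid_grad h \<phi>' x - grid_grad h \<phi> x"
      by (simp add: \<psi>_def vec_eq_iff grid_grad_def ctr_diff_def algebra_simps)
    ultimately show ?thesis
      by (simp add: z_def)
  qed
  have "grid_div h z x = grid_div h w x - grid_div h w' x" for x
    by (simp add: z_def grid_div_def ctr_diff_def algebra_simps sum_subtractf sum.distrib)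
  then have "grid_div h z x = 0" if "x \<in> grid_dom \<Omega> h" for x
    using d that by (simp add: hh_decomp_def)
  moreover have "z x = 0" if "x \<notin> ?K" for x
    using hh_decomp_support(1)[OF d(1) that] hh_decomp_support(1)[OF d(2) that] by (simp add: z_def)
  moreover have "\<psi> x = 0" if "x \<notin> grid_dom \<Omega> h" for x
    using hh_decomp_support(2)[OF d(1) that] hh_decomp_support(2)[OF d(2) that] by (simp add: \<psi>_def)
  ultimately have "(\<Sum>x\<in>?K. z x \<bullet> grid_grad h \<psi> x) = 0"
    using fin by (intro div_free_ortho_grad)
  then have "(\<Sum>x\<in>?K. z x \<bullet> z x) = 0"
    using z by simp
  then have "\<forall>x\<in>?K. z x = 0"
    using fin by (simp add: sum_nonneg_eq_0_iff)
  then show ?thesis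
    using hh_decomp_support(1)[OF d(1)] hh_decomp_support(1)[OF d(2)]
    by (metis eq_iff_diff_eq_0 ext z_def)
qed

text \<open>Existence and uniqueness together make the definite description in
  \<open>hh_proj\<close> meaningful; every property of the projection is read off from here.\<close>

lemma hh_decomp_hh_proj:
  assumes "finite (grid_dom \<Omega> h)" "h \<noteq> 0"
  obtains \<phi> where "hh_decomp \<Omega> h u (hh_proj \<Omega> h u) \<phi>"
proof -
  have "\<exists>!w. \<exists>\<phi>. hh_decomp \<Omega> h u w \<phi>"
    using hh_decomp_exists[OF assms] hh_decomp_unique[OF assms(1)] by blast
  from theI'[OF this] show ?thesis
    using that unfolding hh_proj_def by blast
qed

lemma hh_proj_support:
  assumes "finite (grid_dom \<Omega> h)" "h \<noteq> 0" "x \<notin> dom_int \<Omega> h"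
  shows "hh_proj \<Omega> h u x = 0"
  using hh_decomp_hh_proj[OF assms(1,2), of u] hh_decomp_support(1) assms(3) by metis

lemma grid_div_hh_proj:
  assumes "finite (grid_dom \<Omega> h)" "h \<noteq> 0" "x \<in> grid_dom \<Omega> h"
  shows "grid_div h (hh_proj \<Omega> h u) x = 0"
  using hh_decomp_hh_proj[OF assms(1,2), of u] assms(3) by (metis hh_decomp_def)

lemma L2_set_norm_sq: "(L2_set (\<lambda>x. norm (f x)) K)\<^sup>2 = (\<Sum>x\<in>K. f x \<bullet> f x)"
  by (simp add: L2_set_def sum_nonneg power2_norm_eq_inner)

lemma sum_inner_le_L2_set:
  fixes f g :: "'a \<Rightarrow> 'b::real_inner"
  shows "(\<Sum>x\<in>K. f x \<bullet> g x) \<le> L2_set (\<lambda>x. norm (f x)) K * L2_set (\<lambda>x. norm (g x)) K"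
proof -
  have "(\<Sum>x\<in>K. f x \<bullet> g x) \<le> (\<Sum>x\<in>K. \<bar>norm (f x)\<bar> * \<bar>norm (g x)\<bar>)"
    by (intro sum_mono) (simp add: norm_cauchy_schwarz)
  also have "\<dots> \<le> L2_set (\<lambda>x. norm (f x)) K * L2_set (\<lambda>x. norm (g x)) K"
    by (rule L2_set_mult_ineq)
  finally show ?thesis .
qed

text \<open>By orthogonality to the gradient part, the squared norm of the projection equals its
  inner product with \<open>u\<close>. The norms run over the interior because the decomposition
  equation holds only there.\<close>

lemma L2_set_hh_proj_le:
  assumes fin: "finite (grid_dom \<Omega> h)" and "h \<noteq> 0"
  shows "L2_set (\<lambda>x. norm (hh_proj \<Omega> h u x)) (dom_int \<Omega> h) \<le> L2_set (\<lambda>x. norm (u x)) (dom_int \<Omega> h)"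
    (is "?l \<le> ?r")
proof -
  let ?K = "dom_int \<Omega> h" and ?w = "hh_proj \<Omega> h u"
  obtain \<phi> where d: "hh_decomp \<Omega> h u ?w \<phi>"
    using hh_decomp_hh_proj[OF assms] .
  have "?l\<^sup>2 = (\<Sum>x\<in>?K. ?w x \<bullet> ?w x)"
    by (rule L2_set_norm_sq)
  also have "\<dots> = (\<Sum>x\<in>?K. ?w x \<bullet> ?w x) + (\<Sum>x\<in>?K. ?w x \<bullet> grid_grad h \<phi> x)"
    using fin d hh_decomp_support[OF d]
    by (subst div_free_ortho_grad) (auto simp: hh_decomp_def)
  also have "\<dots> = (\<Sum>x\<in>?K. ?w x \<bullet> u x)"
    using d by (simp add: hh_decomp_def flip: sum.distrib inner_add_right)
  also have "\<dots> \<le> ?l * ?r"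
    by (rule sum_inner_le_L2_set)
  finally have "?l * ?l \<le> ?l * ?r"
    by (simp add: power2_eq_square)
  then show ?thesis
    by (cases "?l = 0") (auto simp: mult_le_cancel_left L2_set_nonneg less_le)
qed

subsection \<open>The implicit step\<close>

text \<open>The scheme multiplied by \<tau>, with all terms in the new velocity \<open>v\<close> on
  one side. The transporting field \<open>u\<close> is the old velocity, so this is linear in
  \<open>v\<close>.\<close>

definition implicit_step ::
  "real \<Rightarrow> real \<Rightarrow> (real^3 \<Rightarrow> real^3) \<Rightarrow> (real^3 \<Rightarrow> real^3) \<Rightarrow> real^3 \<Rightarrow> real^3" where
  "implicit_step h \<tau> u v x =
     v x + (\<tau> / 2) *\<^sub>R convection h u v x - \<tau> *\<^sub>R (\<Sum>j\<in>UNIV. snd_diff h j v x)"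

lemma implicit_step_eq_iff:
  assumes "\<tau> \<noteq> 0"
  shows "(v x - u x) /\<^sub>R \<tau> =
           - ((\<Sum>j\<in>UNIV.
                 (u (x - h *\<^sub>R stdbasis j) $ j) *\<^sub>R ctr_diff h j v (x - h *\<^sub>R stdbasis j)
               + (u (x + h *\<^sub>R stdbasis j) $ j) *\<^sub>R ctr_diff h j v (x + h *\<^sub>R stdbasis j)) /\<^sub>R 2)
           + (\<Sum>j\<in>UNIV. snd_diff h j v x) + F
         \<longleftrightarrow> implicit_step h \<tau> u v x = u x + \<tau> *\<^sub>R F"
proof -
  have "(a - b) /\<^sub>R \<tau> = - (c /\<^sub>R 2) + d + F \<longleftrightarrow> a + (\<tau> / 2) *\<^sub>R c - \<tau> *\<^sub>R d = b + \<tau> *\<^sub>R F"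
    for a b c d :: "real^3"
    using assms by (auto simp: vec_eq_iff field_simps)
  then show ?thesis
    unfolding implicit_step_def convection_def .
qed

lemma implicit_step_linear:
  "implicit_step h \<tau> u (\<lambda>y. a *\<^sub>R f y + g y) x
     = a *\<^sub>R implicit_step h \<tau> u f x + implicit_step h \<tau> u g x"
proof -
  have ctr: "ctr_diff h j (\<lambda>y. a *\<^sub>R f y + g y) y = a *\<^sub>R ctr_diff h j f y + ctr_diff h j g y" for j y
    by (simp add: ctr_diff_def algebra_simps)
  have snd: "snd_diff h j (\<lambda>y. a *\<^sub>R f y + g y) y = a *\<^sub>R snd_diff h j f y + snd_diff h j g y" for j y
    by (simp add: snd_diff_def algebra_simps)
  have "convection h u (\<lambda>y. a *\<^sub>R f y + g y) x = a *\<^sub>R convection h u f x + convection h u g x"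
    unfolding convection_def ctr scaleR_sum_right sum.distrib[symmetric]
    by (intro sum.cong refl) (simp add: algebra_simps)
  then show ?thesis
    unfolding implicit_step_def snd
    by (simp add: sum.distrib algebra_simps flip: scaleR_sum_right)
qed

text \<open>Tested with \<open>v\<close>, the convection contributes nothing and the diffusion
  contributes at least the forward-difference energy.\<close>

lemma implicit_step_energy:
  assumes fin: "finite (grid_dom \<Omega> h)" and "\<tau> \<ge> 0"
    and u: "\<And>x. x \<notin> dom_int \<Omega> h \<Longrightarrow> u x = 0" "\<And>x. x \<in> grid_dom \<Omega> h \<Longrightarrow> grid_div h u x = 0"
    and v: "\<And>x. x \<notin> dom_int \<Omega> h \<Longrightarrow> v x = 0"
  shows "(\<Sum>x\<in>dom_int \<Omega> h. implicit_step h \<tau> u v x \<bullet> v x) \<ge>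
    (\<Sum>x\<in>dom_int \<Omega> h. v x \<bullet> v x)
      + \<tau> * (\<Sum>j\<in>UNIV. \<Sum>x\<in>dom_int \<Omega> h. (norm (fwd_diff h j v x))\<^sup>2)"
proof -
  let ?S = "grid_dom \<Omega> h" and ?K = "dom_int \<Omega> h"
  have "(\<Sum>x\<in>?K. convection h u v x \<bullet> v x) = (\<Sum>x\<in>?S. convection h u v x \<bullet> v x)"
    using fin v by (subst sum_grid_dom_eq_dom_int) auto
  also have "\<dots> = 0"
    using u v by (intro convection_skew fin) auto
  finally have conv: "(\<Sum>x\<in>?K. convection h u v x \<bullet> v x) = 0" .
  have diff: "(\<Sum>x\<in>?K. snd_diff h j v x \<bullet> v x) \<le> - (\<Sum>x\<in>?K. (norm (fwd_diff h j v x))\<^sup>2)" for j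
  proof -
    have "(\<Sum>x\<in>?K. snd_diff h j v x \<bullet> v x) = (\<Sum>x\<in>?S. snd_diff h j v x \<bullet> v x)"
      using fin v by (subst sum_grid_dom_eq_dom_int) auto
    also have "\<dots> \<le> - (\<Sum>x\<in>?S. (norm (fwd_diff h j v x))\<^sup>2)"
      using fin v by (intro snd_diff_dissipative) auto
    \<comment> \<open>Boundary points are dropped here because the Poincare inequality bounds by a
      sum over the interior.\<close>
    also have "\<dots> \<le> - (\<Sum>x\<in>?K. (norm (fwd_diff h j v x))\<^sup>2)"
      using fin by (simp add: sum_mono2)
    finally show ?thesis .
  qed
  have "(\<Sum>x\<in>?K. implicit_step h \<tau> u v x \<bullet> v x) = (\<Sum>x\<in>?K. v x \<bullet> v x)
      + \<tau> / 2 * (\<Sum>x\<in>?K. convection h u v x \<bullet> v x) - \<tau> * (\<Sum>x\<in>?K. \<Sum>j\<in>UNIV. snd_diff h j v x \<bullet> v x)"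
    by (simp add: implicit_step_def inner_add_left inner_diff_left inner_sum_left
        sum.distrib sum_subtractf sum_distrib_left)
  moreover have "\<tau> * (\<Sum>x\<in>?K. \<Sum>j\<in>UNIV. snd_diff h j v x \<bullet> v x)
      \<le> \<tau> * (\<Sum>j\<in>UNIV. - (\<Sum>x\<in>?K. (norm (fwd_diff h j v x))\<^sup>2))"
    using assms(2) diff by (subst sum.swap) (intro mult_left_mono sum_mono)
  ultimately show ?thesis
    by (simp add: conv sum_negf)
qed

text \<open>The identity term alone already makes the energy form definite, so no relation between
  \<tau> and \<open>h\<close> enters.\<close>

lemma implicit_step_solvable:
  assumes fin: "finite (grid_dom \<Omega> h)" and "\<tau> \<ge> 0"
    and u: "\<And>x. x \<notin> dom_int \<Omega> h \<Longrightarrow> u x = 0" "\<And>x. x \<in> grid_dom \<Omega> h \<Longrightarrow> grid_div h u x = 0"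
  shows "\<exists>!v. (\<forall>x. x \<notin> dom_int \<Omega> h \<longrightarrow> v x = 0) \<and> (\<forall>x\<in>dom_int \<Omega> h. implicit_step h \<tau> u v x = b x)"
proof (rule definite_linear_solvable)
  show "finite (dom_int \<Omega> h)"
    using fin by simp
next
  fix v
  assume v: "\<And>x. x \<notin> dom_int \<Omega> h \<Longrightarrow> v x = 0"
    and le: "(\<Sum>x\<in>dom_int \<Omega> h. implicit_step h \<tau> u v x \<bullet> v x) \<le> 0"
  have "0 \<le> \<tau> * (\<Sum>j\<in>UNIV. \<Sum>x\<in>dom_int \<Omega> h. (norm (fwd_diff h j v x))\<^sup>2)"
    using assms(2) by (intro mult_nonneg_nonneg sum_nonneg) auto
  then have "(\<Sum>x\<in>dom_int \<Omega> h. v x \<bullet> v x) \<le> 0"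
    using implicit_step_energy[OF assms, of v] v le by fastforce
  then have "(\<Sum>x\<in>dom_int \<Omega> h. v x \<bullet> v x) = 0"
    by (intro antisym sum_nonneg) auto
  then have "\<forall>x\<in>dom_int \<Omega> h. v x = 0"
    using fin by (simp add: sum_nonneg_eq_0_iff)
  with v show "v = (\<lambda>x. 0)"
    by blast
qed (rule implicit_step_linear)

text \<open>From the first step on, the support and boundary conditions merge into vanishing off the
  interior; the initial datum is only asked to vanish off the grid domain.\<close>

lemma dNS_solution_iff:
  assumes "\<tau> \<noteq> 0"
  shows "dNS_solution \<Omega> h \<tau> f v0 v \<longleftrightarrow> v 0 = v0 \<and> v0 \<in> grid_fun \<Omega> h \<and>
    (\<forall>n. (\<forall>x. x \<notin> dom_int \<Omega> h \<longrightarrow> v (Suc n) x = 0) \<and>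
      (\<forall>x\<in>dom_int \<Omega> h. implicit_step h \<tau> (hh_proj \<Omega> h (v n)) (v (Suc n)) x
         = hh_proj \<Omega> h (v n) x + \<tau> *\<^sub>R cell_avg h \<tau> f n x))"
proof -
  have "(\<forall>n. v n \<in> grid_fun \<Omega> h) \<longleftrightarrow> v 0 \<in> grid_fun \<Omega> h \<and> (\<forall>n. v (Suc n) \<in> grid_fun \<Omega> h)"
    by (metis not0_implies_Suc)
  moreover have "w \<in> grid_fun \<Omega> h \<and> (\<forall>x\<in>dom_bdry \<Omega> h. w x = 0) \<longleftrightarrow> (\<forall>x. x \<notin> dom_int \<Omega> h \<longrightarrow> w x = 0)"
    for w :: "real^3 \<Rightarrow> real^3"
    by (auto simp: grid_fun_def grid_bdry_def)
  ultimately show ?thesis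
    unfolding dNS_solution_def Let_def implicit_step_eq_iff[OF assms] by blast
qed

lemma dNS_solution_ex1:
  assumes fin: "finite (grid_dom \<Omega> h)" and "h \<noteq> 0" "\<tau> > 0" and v0: "v0 \<in> grid_fun \<Omega> h"
  shows "\<exists>!v. dNS_solution \<Omega> h \<tau> f v0 v"
proof -
  define step where "step n w w' \<longleftrightarrow> (\<forall>x. x \<notin> dom_int \<Omega> h \<longrightarrow> w' x = 0) \<and>
      (\<forall>x\<in>dom_int \<Omega> h. implicit_step h \<tau> (hh_proj \<Omega> h w) w' x
         = hh_proj \<Omega> h w x + \<tau> *\<^sub>R cell_avg h \<tau> f n x)" for n w w'
  have sol: "dNS_solution \<Omega> h \<tau> f v0 v \<longleftrightarrow> v 0 = v0 \<and> (\<forall>n. step n (v n) (v (Suc n)))" for v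
    using assms by (auto simp: dNS_solution_iff step_def)
  have ex1: "\<exists>!w'. step n w w'" for n w
    unfolding step_def using assms
    by (intro implicit_step_solvable) (auto simp: hh_proj_support grid_div_hh_proj)
  define v where "v = rec_nat v0 (\<lambda>n w. THE w'. step n w w')"
  have v: "v 0 = v0" "step n (v n) (v (Suc n))" for n
    using theI'[OF ex1] by (simp_all add: v_def)
  moreover have "v' = v" if "v' 0 = v0" "\<And>n. step n (v' n) (v' (Suc n))" for v'
  proof
    show "v' n = v n" for n
    proof (induction n)
      case (Suc n)
      then show ?case
        using v(2)[of n] that(2)[of n] ex1[of n "v n"] by auto
    qed (simp add: v(1) that(1))
  qed
  ultimately show ?thesis
    unfolding sol by (intro ex1I[of _ v]) blast+
qed

subsection \<open>Cell averages of the forcing\<close>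

text \<open>With \<open>q\<close> the measure of \<open>Q\<close> and \<open>I\<close> the integral
  of \<open>F\<close>, expanding the integral of the squared norm of \<open>q F - I\<close> gives
  \<open>q\<close> times the difference of the two sides of the inequality. Integrability of
  \<open>F\<close> follows from its square integrability, as \<open>Q\<close> has finite
  measure.\<close>

lemma set_integral_cauchy_schwarz:
  fixes F :: "'a \<Rightarrow> 'b::euclidean_space"
  assumes Q: "Q \<in> sets M" "emeasure M Q < \<infinity>"
    and meas: "set_borel_measurable M Q F"
    and sq: "set_integrable M Q (\<lambda>p. (norm (F p))\<^sup>2)"
  shows "set_integrable M Q F"
    and "(norm (LINT p:Q|M. F p))\<^sup>2 \<le> measure M Q * (LINT p:Q|M. (norm (F p))\<^sup>2)"
proof -
  have const: "set_integrable M Q (\<lambda>p. c)" for c :: real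
    using Q by (simp add: set_integrable_def)
  show int: "set_integrable M Q F"
  proof (rule set_integrable_bound[of M Q "\<lambda>p. 1 + (norm (F p))\<^sup>2"])
    show "set_integrable M Q (\<lambda>p. 1 + (norm (F p))\<^sup>2)"
      using const sq by (rule set_integral_add)
    have "norm (F p) \<le> 1 + (norm (F p))\<^sup>2" for p
    proof -
      have "0 \<le> (norm (F p) - 1)\<^sup>2"
        by simp
      then have "2 * norm (F p) \<le> 1 + (norm (F p))\<^sup>2"
        by (simp add: power2_diff)
      then show ?thesis
        using norm_ge_zero[of "F p"] by linarith
    qed
    then show "AE p in M. p \<in> Q \<longrightarrow> norm (F p) \<le> norm (1 + (norm (F p))\<^sup>2)"
      by (intro AE_I2) (smt (verit) real_norm_def zero_le_power2)
  qed (use meas in \<open>simp_all add: set_borel_measurable_def\<close>)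
  define I where "I = (LINT p:Q|M. F p)"
  define q where "q = measure M Q"
  have lin: "set_integrable M Q (\<lambda>p. F p \<bullet> c)" "(LINT p:Q|M. F p \<bullet> c) = I \<bullet> c" for c
    using integrable_inner_left[of c M "\<lambda>p. indicator Q p *\<^sub>R F p"]
      integral_inner_left[of c M "\<lambda>p. indicator Q p *\<^sub>R F p"] int
    by (auto simp: set_integrable_def set_lebesgue_integral_def I_def)
  have cst: "(LINT p:Q|M. c) = q * c" for c :: real
    using Q by (simp add: set_lebesgue_integral_def q_def)
  have "0 \<le> (LINT p:Q|M. (norm (q *\<^sub>R F p - I))\<^sup>2)"
    unfolding set_lebesgue_integral_def by (intro integral_nonneg_AE AE_I2) simp
  also have "\<dots> = (LINT p:Q|M. (q\<^sup>2 * (norm (F p))\<^sup>2 - 2 * q * (F p \<bullet> I)) + (norm I)\<^sup>2)"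
    unfolding power2_norm_eq_inner
    by (intro arg_cong[where f = "set_lebesgue_integral M Q"] ext)
      (simp add: inner_diff_left inner_diff_right inner_commute power2_eq_square)
  also have "\<dots> = q\<^sup>2 * (LINT p:Q|M. (norm (F p))\<^sup>2) - 2 * q * (I \<bullet> I) + q * (norm I)\<^sup>2"
    using sq lin(1)[of I] const
    by (simp add: set_integral_add set_integral_diff cst lin(2))
  also have "\<dots> = q * (q * (LINT p:Q|M. (norm (F p))\<^sup>2) - (norm I)\<^sup>2)"
    by (simp add: algebra_simps power2_eq_square flip: power2_norm_eq_inner)
  finally have *: "0 \<le> q * (q * (LINT p:Q|M. (norm (F p))\<^sup>2) - (norm I)\<^sup>2)" .
  show "(norm I)\<^sup>2 \<le> q * (LINT p:Q|M. (norm (F p))\<^sup>2)"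
  \<comment> \<open>The expansion says nothing on a null set, where \<open>I\<close> is zero
    anyway.\<close>
  proof (cases "q = 0")
    case True
    then have "emeasure M Q = 0"
      using Q by (auto simp: q_def measure_def enn2real_eq_0_iff)
    then have "AE p in M. p \<notin> Q"
      using Q(1) by (intro AE_not_in) (simp add: null_sets_def)
    then have "I = 0"
      unfolding I_def set_lebesgue_integral_def by (intro integral_eq_zero_AE) auto
    then show ?thesis by (simp add: True)
  next
    case False
    then have "q > 0" by (simp add: q_def zero_less_measure_iff)
    then show ?thesis using * by (simp add: zero_le_mult_iff)
  qed
qed

text \<open>At almost every point at most one indicator is nonzero. Disjointness is needed only
  almost everywhere because the intended closed cells share faces.\<close>

lemma sum_set_integral_le_AE_disjoint:
  fixes F :: "'a \<Rightarrow> real"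
  assumes "finite I" and F: "\<And>p. F p \<ge> 0"
    and int: "\<And>i. i \<in> I \<Longrightarrow> set_integrable M (A i) F" "set_integrable M W F"
    and sub: "\<And>i. i \<in> I \<Longrightarrow> A i \<subseteq> W"
    and disj: "\<And>i j. i \<in> I \<Longrightarrow> j \<in> I \<Longrightarrow> i \<noteq> j \<Longrightarrow> AE p in M. \<not> (p \<in> A i \<and> p \<in> A j)"
  shows "(\<Sum>i\<in>I. LINT p:A i|M. F p) \<le> (LINT p:W|M. F p)"
proof -
  have "AE p in M. \<forall>i\<in>I. \<forall>j\<in>I. i \<noteq> j \<longrightarrow> \<not> (p \<in> A i \<and> p \<in> A j)"
    using assms(1) disj by (intro AE_finite_allI) (auto intro: AE_impI)
  then have "AE p in M. (\<Sum>i\<in>I. indicator (A i) p *\<^sub>R F p) \<le> indicator W p *\<^sub>R F p"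
  proof (rule eventually_mono)
    fix p
    assume *: "\<forall>i\<in>I. \<forall>j\<in>I. i \<noteq> j \<longrightarrow> \<not> (p \<in> A i \<and> p \<in> A j)"
    show "(\<Sum>i\<in>I. indicator (A i) p *\<^sub>R F p) \<le> indicator W p *\<^sub>R F p"
    proof (cases "\<exists>i\<in>I. p \<in> A i")
      case True
      then obtain i where i: "i \<in> I" "p \<in> A i" by blast
      have "(\<Sum>j\<in>I. indicator (A j) p *\<^sub>R F p) = (\<Sum>j\<in>{i}. indicator (A j) p *\<^sub>R F p)"
        using assms(1) i * by (intro sum.mono_neutral_right) (auto simp: indicator_def)
      then show ?thesis
        using i sub by (auto simp: indicator_def)
    next
      case False
      then show ?thesis
        using F[of p] by (auto simp: indicator_def intro!: order_trans[OF eq_refl[OF sum.neutral]])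
    qed
  qed
  moreover have "integrable M (\<lambda>p. \<Sum>i\<in>I. indicator (A i) p *\<^sub>R F p)"
    using int(1) by (intro Bochner_Integration.integrable_sum) (simp add: set_integrable_def)
  moreover have "(\<Sum>i\<in>I. LINT p:A i|M. F p) = (LINT p|M. (\<Sum>i\<in>I. indicator (A i) p *\<^sub>R F p))"
    unfolding set_lebesgue_integral_def using int(1)
    by (subst Bochner_Integration.integral_sum) (simp_all add: set_integrable_def)
  ultimately show ?thesis
    using int(2) unfolding set_lebesgue_integral_def set_integrable_def
    by (simp add: integral_mono_AE)
qed

text \<open>Fubini. The averages and the norm of the forcing are iterated integrals, whereas the
  estimates work with integrals over product sets.\<close>

lemma set_integral_Times_lborel:
  fixes F :: "'a::euclidean_space \<times> 'b::euclidean_space \<Rightarrow> 'c::euclidean_space"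
  assumes "set_integrable lborel (A \<times> B) F"
  shows "(LINT t:A|lborel. LINT y:B|lborel. F (t, y)) = (LINT p:A \<times> B|lborel. F p)"
proof -
  have "integrable (lborel \<Otimes>\<^sub>M lborel) (\<lambda>p. indicator (A \<times> B) p *\<^sub>R F p)"
    using assms by (simp add: lborel_prod set_integrable_def)
  then have "(LINT p:A \<times> B|lborel. F p)
      = (LINT t|lborel. LINT y|lborel. indicator (A \<times> B) (t, y) *\<^sub>R F (t, y))"
    unfolding set_lebesgue_integral_def by (subst lborel_pair.integral_fst') (simp_all add: lborel_prod)
  also have "\<dots> = (LINT t:A|lborel. LINT y:B|lborel. F (t, y))"
    unfolding set_lebesgue_integral_def
    by (intro Bochner_Integration.integral_cong refl) (auto simp: indicator_def)
  finally show ?thesis by simp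
qed

section \<open>Space-time cells and their overlaps\<close>

lemma cube_eq_cbox: "cube h x = cbox (x - (\<chi> i. h / 2)) (x + (\<chi> i. h / 2))"
  by (auto simp: cube_def mem_box_cart)

abbreviation spacetime_cell :: "real \<Rightarrow> real \<Rightarrow> nat \<Rightarrow> real^3 \<Rightarrow> (real \<times> (real^3)) set" where
  "spacetime_cell h \<tau> n x \<equiv> {\<tau> * real n..\<tau> * (real n + 1)} \<times> cube h x"

lemma spacetime_cell_eq_cbox:
  "spacetime_cell h \<tau> n x =
     cbox (\<tau> * real n, x - (\<chi> i. h / 2)) (\<tau> * (real n + 1), x + (\<chi> i. h / 2))"
  by (simp add: cube_eq_cbox cbox_Pair_eq)

lemma measure_spacetime_cell:
  assumes "h > 0" "\<tau> > 0"
  shows "measure lborel (spacetime_cell h \<tau> n x) = \<tau> * h ^ 3"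
proof -
  have "measure lborel (cube h x) = h ^ 3"
    unfolding cube_eq_cbox using assms(1)
    by (subst content_cbox_cart) (auto simp: interval_ne_empty_cart)
  then show ?thesis
    unfolding spacetime_cell_eq_cbox content_Pair using assms(2)
    by (simp add: cube_eq_cbox algebra_simps)
qed

lemma null_sets_hyperplane:
  fixes a :: "'a::euclidean_space"
  assumes "a \<noteq> 0"
  shows "{p. a \<bullet> p = c} \<in> null_sets lborel"
proof -
  have "{p. a \<bullet> p = c} \<in> sets borel"
    by (intro borel_closed closed_hyperplane)
  then show ?thesis
    using negligible_hyperplane[of a c] assms
    by (auto simp: negligible_iff_null_sets null_sets_def)
qed

text \<open>Distinct cells are a full step apart in time or in some space coordinate, since distinct
  integers differ by at least 1. They meet at most in a common face, which lies in a
  hyperplane.\<close>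

lemma spacetime_cells_AE_disjoint:
  assumes "h > 0" "\<tau> > 0" "x \<in> grid h" "x' \<in> grid h" "(n, x) \<noteq> (n', x')"
  shows "AE p in lborel. \<not> (p \<in> spacetime_cell h \<tau> n x \<and> p \<in> spacetime_cell h \<tau> n' x')"
proof -
  \<comment> \<open>Stated for arbitrary indices and centres, so that the reversed orderings follow
    by exchanging the two cells.\<close>
  have "\<exists>a c. a \<noteq> 0 \<and> (\<forall>p \<in> spacetime_cell h \<tau> n x \<inter> spacetime_cell h \<tau> n' x'. a \<bullet> p = c)"
    if "(n < n') \<or> (\<exists>i. x $ i + h \<le> x' $ i)" for n n' and x x' :: "real^3"
    using that
  proof
    assume "n < n'"
    then have "\<tau> * (real n + 1) \<le> \<tau> * real n'"
      using assms(2) by simp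
    then have "\<forall>p \<in> spacetime_cell h \<tau> n x \<inter> spacetime_cell h \<tau> n' x'. (1::real, 0::real^3) \<bullet> p = \<tau> * real n'"
      by (auto simp: inner_Pair)
    then show ?thesis
      by (intro exI[of _ "(1, 0)"] exI conjI) (auto simp: zero_prod_def)
  next
    assume "\<exists>i. x $ i + h \<le> x' $ i"
    then obtain i where i: "x $ i + h \<le> x' $ i" ..
    have "y $ i = x $ i + h / 2" if "y \<in> cube h x" "y \<in> cube h x'" for y
    proof -
      have "y $ i \<le> x $ i + h / 2" "x' $ i - h / 2 \<le> y $ i"
        using that by (auto simp: cube_def)
      then show ?thesis using i by linarith
    qed
    then have "\<forall>p \<in> spacetime_cell h \<tau> n x \<inter> spacetime_cell h \<tau> n' x'. (0::real, stdbasis i) \<bullet> p = x $ i + h / 2"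
      by (auto simp: inner_Pair cart_eq_inner_axis inner_commute)
    then show ?thesis
      by (intro exI[of _ "(0, stdbasis i)"] exI conjI) (auto simp: zero_prod_def axis_eq_0_iff)
  qed
  moreover have "n < n' \<or> n' < n \<or> (\<exists>i. x $ i + h \<le> x' $ i) \<or> (\<exists>i. x' $ i + h \<le> x $ i)"
  proof (cases "n = n'")
    case True
    then obtain i where i: "x $ i \<noteq> x' $ i"
      using assms(5) by (auto simp: vec_eq_iff)
    obtain z z' :: "int^3" where z: "x = (\<chi> i. h * of_int (z $ i))" "x' = (\<chi> i. h * of_int (z' $ i))"
      using assms(3,4) by (auto simp: grid_def)
    then have "z $ i + 1 \<le> z' $ i \<or> z' $ i + 1 \<le> z $ i"
      using i by auto
    then have "h * of_int (z $ i + 1) \<le> h * of_int (z' $ i) \<or> h * of_int (z' $ i + 1) \<le> h * of_int (z $ i)"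
      using assms(1) by (simp only: mult_le_cancel_left_pos of_int_le_iff)
    then show ?thesis
      by (auto simp: z algebra_simps)
  qed auto
  ultimately obtain a :: "real \<times> (real^3)" and c where "a \<noteq> 0"
    "\<forall>p \<in> spacetime_cell h \<tau> n x \<inter> spacetime_cell h \<tau> n' x'. a \<bullet> p = c"
    by (metis Int_commute)
  moreover from this(1) have "AE p in lborel. p \<notin> {p. a \<bullet> p = c}"
    by (intro AE_not_in null_sets_hyperplane)
  ultimately show ?thesis
    by (auto elim!: eventually_mono)
qed

text \<open>By Cauchy-Schwarz each weighted squared average is at most the integral of the squared
  forcing over its cell. The cells of \<open>T1\<close> consecutive time layers overlap only in null
  sets and fill part of the slab \<open>W\<close>.\<close>

lemma sum_cell_avg_le:
  assumes fin: "finite (grid_dom \<Omega> h)" and "open \<Omega>" and h: "h > 0" and f: "L2loc_L2 \<Omega> f"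
    and T1: "T1 \<ge> 1" "\<tau> = 1 / real T1"
  shows "(\<Sum>k<T1. \<tau> * (\<Sum>x\<in>grid_dom \<Omega> h. (norm (cell_avg h \<tau> f (m * T1 + k) x))\<^sup>2 * h ^ 3))
    \<le> (L2_L2_norm (real m) (real m + 1) \<Omega> f)\<^sup>2"
proof -
  have \<tau>: "\<tau> > 0" using T1 by simp
  define F where "F = (\<lambda>(t, y). f t y)"
  let ?sq = "\<lambda>p. (norm (F p))\<^sup>2"
  define W where "W = {real m..real m + 1} \<times> \<Omega>"
  define I where "I = (\<lambda>k. m * T1 + k) ` {..<T1} \<times> grid_dom \<Omega> h"
  let ?Q = "\<lambda>(n, x). spacetime_cell h \<tau> n x"
  have meas_F: "set_borel_measurable lborel ({0..} \<times> \<Omega>) F"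
    using f by (simp add: L2loc_L2_def F_def)
  have W: "W \<in> sets lborel"
    unfolding W_def using assms(2) by (simp add: borel_Times)
  have sq_W: "set_integrable lborel W ?sq"
  proof -
    have "set_integrable lborel ({0..real m + 1} \<times> \<Omega>) ?sq"
      using f by (simp add: L2loc_L2_def F_def case_prod_beta')
    then show ?thesis
      by (rule set_integrable_subset) (use W in \<open>auto simp: W_def\<close>)
  qed
  have finI: "finite I"
    using fin by (simp add: I_def)
  have Q_sets: "?Q j \<in> sets lborel" for j
    by (cases j) (simp add: spacetime_cell_eq_cbox)
  have QW: "?Q j \<subseteq> W" if "j \<in> I" for j
  proof -
    obtain k x where j: "j = (m * T1 + k, x)" "k < T1" "x \<in> grid_dom \<Omega> h"
      using \<open>j \<in> I\<close> unfolding I_def by blast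
    have "x $ i - 4 * h / 2 \<le> y $ i \<and> y $ i \<le> x $ i + 4 * h / 2" if "y \<in> cube h x" for y i
    proof -
      have "x $ i - h / 2 \<le> y $ i" "y $ i \<le> x $ i + h / 2"
        using that by (auto simp: cube_def)
      then show ?thesis
        using h by (intro conjI) linarith+
    qed
    then have "cube h x \<subseteq> cube (4 * h) x"
      by (auto simp: cube_def[of "4 * h"])
    then have "cube h x \<subseteq> \<Omega>"
      using j(3) by (auto simp: grid_dom_def)
    \<comment> \<open>Since \<open>\<tau> * T1 = 1\<close>, layer \<open>k\<close> covers the times
      from \<open>m + k / T1\<close> to \<open>m + (k + 1) / T1\<close>, and the last layer ends
      exactly at \<open>m + 1\<close>.\<close>
    moreover have "\<tau> * real (m * T1 + k) = real m + real k / real T1"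
      "\<tau> * (real (m * T1 + k) + 1) = real m + (real k + 1) / real T1"
      using T1(1) by (simp_all add: T1(2) field_simps)
    moreover have "0 \<le> real k / real T1" "(real k + 1) / real T1 \<le> 1"
      using j(2) by simp_all
    ultimately have "real m \<le> \<tau> * real (m * T1 + k)" "\<tau> * (real (m * T1 + k) + 1) \<le> real m + 1"
      by linarith+
    then show ?thesis
      using \<open>cube h x \<subseteq> \<Omega>\<close> by (auto simp: j(1) W_def)
  qed
  have sq_Q: "set_integrable lborel (?Q j) ?sq" if "j \<in> I" for j
    using sq_W Q_sets QW[OF that] by (rule set_integrable_subset)
  \<comment> \<open>The cell has measure \<open>\<tau> * h ^ 3\<close>, so the left side is the
    squared norm of the integral over the cell divided by that measure.\<close>
  have cell: "\<tau> * ((norm (cell_avg h \<tau> f n x))\<^sup>2 * h ^ 3) \<le> (LINT p:?Q (n, x)|lborel. ?sq p)"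
    if "(n, x) \<in> I" for n x
  proof -
    let ?C = "spacetime_cell h \<tau> n x"
    have "?C \<subseteq> {0..} \<times> \<Omega>"
      using QW[OF that] by (auto simp: W_def)
    then have meas: "set_borel_measurable lborel ?C F"
      using meas_F Q_sets[of "(n, x)"] by (auto intro: set_borel_measurable_subset)
    have C: "?C \<in> sets lborel" "emeasure lborel ?C < \<infinity>"
      using emeasure_bounded_finite[OF bounded_cbox] by (simp_all add: spacetime_cell_eq_cbox)
    note cs = set_integral_cauchy_schwarz[OF C meas sq_Q[OF that, simplified]]
    have "cell_avg h \<tau> f n x = (LINT p:?C|lborel. F p) /\<^sub>R (\<tau> * h ^ 3)"
      unfolding cell_avg_def set_integral_Times_lborel[OF cs(1), symmetric] by (simp add: F_def)
    then have "\<tau> * ((norm (cell_avg h \<tau> f n x))\<^sup>2 * h ^ 3) = (norm (LINT p:?C|lborel. F p))\<^sup>2 / (\<tau> * h ^ 3)"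
      using \<tau> h by (simp add: power_divide power_mult_distrib divide_simps power2_eq_square)
    also have "\<dots> \<le> (LINT p:?C|lborel. ?sq p)"
      using cs(2) \<tau> h unfolding measure_spacetime_cell[OF h \<tau>] by (simp add: divide_le_eq mult.commute)
    finally show ?thesis by simp
  qed
  have "(\<Sum>k<T1. \<tau> * (\<Sum>x\<in>grid_dom \<Omega> h. (norm (cell_avg h \<tau> f (m * T1 + k) x))\<^sup>2 * h ^ 3))
      = (\<Sum>(n, x)\<in>I. \<tau> * ((norm (cell_avg h \<tau> f n x))\<^sup>2 * h ^ 3))"
    unfolding I_def by (simp add: sum_distrib_left sum.reindex inj_on_def flip: sum.cartesian_product)
  also have "\<dots> \<le> (\<Sum>j\<in>I. LINT p:?Q j|lborel. ?sq p)"
    using cell by (intro sum_mono) auto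
  also have "\<dots> \<le> (LINT p:W|lborel. ?sq p)"
  proof (rule sum_set_integral_le_AE_disjoint)
    fix i j
    assume "i \<in> I" "j \<in> I" "i \<noteq> j"
    then show "AE p in lborel. \<not> (p \<in> ?Q i \<and> p \<in> ?Q j)"
      using spacetime_cells_AE_disjoint[OF h \<tau>, of "snd i" "snd j" "fst i" "fst j"]
      by (auto simp: I_def grid_dom_def)
  qed (use finI sq_Q sq_W QW in simp_all)
  also have "\<dots> = (LINT t:{real m..real m + 1}|lborel. LINT y:\<Omega>|lborel. (norm (f t y))\<^sup>2)"
    unfolding W_def set_integral_Times_lborel[OF sq_W[unfolded W_def], symmetric] by (simp add: F_def)
  also have "\<dots> = (L2_L2_norm (real m) (real m + 1) \<Omega> f)\<^sup>2"
    unfolding L2_L2_norm_def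
    by (subst real_sqrt_pow2) (auto simp: set_lebesgue_integral_def intro!: integral_nonneg_AE)
  finally show ?thesis .
qed

subsection \<open>Decay over a unit of time\<close>

lemma grid_norm_eq_L2_set:
  assumes "finite (grid_dom \<Omega> h)" "h > 0" and "\<And>x. x \<notin> dom_int \<Omega> h \<Longrightarrow> v x = 0"
  shows "grid_norm \<Omega> h v = sqrt (h ^ 3) * L2_set (\<lambda>x. norm (v x)) (dom_int \<Omega> h)"
proof -
  have "(\<Sum>x\<in>grid_dom \<Omega> h. (norm (v x))\<^sup>2 * h ^ 3) = (\<Sum>x\<in>dom_int \<Omega> h. (norm (v x))\<^sup>2 * h ^ 3)"
    using assms by (intro sum_grid_dom_eq_dom_int) auto
  then show ?thesis
    by (simp add: grid_norm_def L2_set_def sum_distrib_left mult.commute flip: real_sqrt_mult)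
qed

text \<open>Meant for the forcing, whose averages need not vanish at boundary points; hence no
  equality.\<close>

lemma L2_set_le_grid_norm:
  assumes "finite (grid_dom \<Omega> h)" "h > 0"
  shows "sqrt (h ^ 3) * L2_set (\<lambda>x. norm (v x)) (dom_int \<Omega> h) \<le> grid_norm \<Omega> h v"
proof -
  have "(\<Sum>x\<in>dom_int \<Omega> h. (norm (v x))\<^sup>2 * h ^ 3) \<le> (\<Sum>x\<in>grid_dom \<Omega> h. (norm (v x))\<^sup>2 * h ^ 3)"
    using assms by (intro sum_mono2) auto
  then show ?thesis
    by (simp add: grid_norm_def L2_set_def sum_distrib_left mult.commute flip: real_sqrt_mult)
qed

text \<open>Componentwise application of the scalar inequality. A single direction \<open>i\<close>
  suffices on the right, which is what later allows three such bounds to be added.\<close>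

lemma poincare_vector:
  fixes v :: "real^3 \<Rightarrow> real^3"
  assumes "lipschitz_domain \<Omega>" "poincare_const A" "admissible_mesh \<Omega> h"
    and fin: "finite (grid_dom \<Omega> h)" and v: "\<And>x. x \<notin> dom_int \<Omega> h \<Longrightarrow> v x = 0"
  shows "(\<Sum>x\<in>dom_int \<Omega> h. v x \<bullet> v x)
    \<le> (A (diameter \<Omega>))\<^sup>2 * (\<Sum>x\<in>dom_int \<Omega> h. (norm (fwd_diff h i v x))\<^sup>2)"
proof -
  let ?K = "dom_int \<Omega> h"
  have comp: "(\<Sum>x\<in>?K. \<bar>v x $ k\<bar>\<^sup>2)
      \<le> (A (diameter \<Omega>))\<^sup>2 * (\<Sum>x\<in>?K. \<bar>fwd_diff h i (\<lambda>y. v y $ k) x\<bar>\<^sup>2)" for k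
  proof -
    have "(\<Sum>x\<in>?K. \<bar>v x $ k\<bar>\<^sup>2) = (\<Sum>x\<in>grid_dom \<Omega> h. \<bar>v x $ k\<bar>\<^sup>2)"
      using fin v by (subst sum_grid_dom_eq_dom_int) auto
    moreover have "(\<lambda>y. v y $ k) \<in> grid_fun \<Omega> h" "\<forall>x\<in>dom_bdry \<Omega> h. v x $ k = 0"
      using v by (auto simp: grid_fun_def)
    ultimately show ?thesis
      using assms(1-3) unfolding poincare_const_def by simp
  qed
  have norm: "(norm w)\<^sup>2 = (\<Sum>k\<in>UNIV. \<bar>w $ k\<bar>\<^sup>2)" for w :: "real^3"
    unfolding power2_norm_eq_inner inner_vec_def by (simp add: power2_eq_square)
  have fwd: "fwd_diff h i v x $ k = fwd_diff h i (\<lambda>y. v y $ k) x" for x k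
    by (simp add: fwd_diff_def)
  have "(\<Sum>x\<in>?K. v x \<bullet> v x) = (\<Sum>k\<in>UNIV. \<Sum>x\<in>?K. \<bar>v x $ k\<bar>\<^sup>2)"
    by (subst sum.swap) (simp add: norm flip: power2_norm_eq_inner)
  also have "\<dots> \<le> (\<Sum>k\<in>UNIV. (A (diameter \<Omega>))\<^sup>2 * (\<Sum>x\<in>?K. \<bar>fwd_diff h i (\<lambda>y. v y $ k) x\<bar>\<^sup>2))"
    by (intro sum_mono comp)
  also have "\<dots> = (A (diameter \<Omega>))\<^sup>2 * (\<Sum>x\<in>?K. (norm (fwd_diff h i v x))\<^sup>2)"
    unfolding norm fwd sum_distrib_left[symmetric] by (subst sum.swap) simp
  finally show ?thesis .
qed

text \<open>Test the step equation with \<open>v\<close>: the energy estimate and the Poincare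
  inequality bound the result from below, Cauchy-Schwarz and the contraction property of the
  projection from above; then divide by the norm of \<open>v\<close>.\<close>

lemma implicit_step_decay:
  assumes dom: "lipschitz_domain \<Omega>" "poincare_const A" "admissible_mesh \<Omega> h"
    and fin: "finite (grid_dom \<Omega> h)" and "h > 0" "\<tau> > 0"
    and w: "\<And>x. x \<notin> dom_int \<Omega> h \<Longrightarrow> w x = 0" and v: "\<And>x. x \<notin> dom_int \<Omega> h \<Longrightarrow> v x = 0"
    and step: "\<And>x. x \<in> dom_int \<Omega> h \<Longrightarrow>
      implicit_step h \<tau> (hh_proj \<Omega> h w) v x = hh_proj \<Omega> h w x + \<tau> *\<^sub>R F x"
  shows "(1 + 3 * (1 / (A (diameter \<Omega>))\<^sup>2) * \<tau>) * grid_norm \<Omega> h v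
    \<le> grid_norm \<Omega> h w + \<tau> * grid_norm \<Omega> h F"
proof -
  let ?K = "dom_int \<Omega> h" and ?u = "hh_proj \<Omega> h w"
  let ?N = "\<lambda>v. L2_set (\<lambda>x. norm (v x)) ?K"
  define a where "a = 1 / (A (diameter \<Omega>))\<^sup>2"
  have A: "A (diameter \<Omega>) > 0"
    using dom(1,2) by (simp add: poincare_const_def)
  have "a * (?N v)\<^sup>2 \<le> (\<Sum>x\<in>?K. (norm (fwd_diff h j v x))\<^sup>2)" for j
    using poincare_vector[where v = v and i = j, OF dom fin v] A
    by (simp add: a_def L2_set_norm_sq divide_le_eq mult.commute)
  \<comment> \<open>The three directions each contribute \<open>a\<close>, whence the factor 3 in
    the decay rate.\<close>
  then have "(\<Sum>j\<in>(UNIV :: 3 set). a * (?N v)\<^sup>2) \<le> (\<Sum>j\<in>UNIV. \<Sum>x\<in>?K. (norm (fwd_diff h j v x))\<^sup>2)"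
    by (intro sum_mono)
  then have "\<tau> * (3 * a * (?N v)\<^sup>2) \<le> \<tau> * (\<Sum>j\<in>UNIV. \<Sum>x\<in>?K. (norm (fwd_diff h j v x))\<^sup>2)"
    using \<open>\<tau> > 0\<close> by (intro mult_left_mono) auto
  then have "(1 + 3 * a * \<tau>) * (?N v)\<^sup>2
      \<le> (\<Sum>x\<in>?K. v x \<bullet> v x) + \<tau> * (\<Sum>j\<in>UNIV. \<Sum>x\<in>?K. (norm (fwd_diff h j v x))\<^sup>2)"
    by (simp add: L2_set_norm_sq algebra_simps)
  also have "\<dots> \<le> (\<Sum>x\<in>?K. implicit_step h \<tau> ?u v x \<bullet> v x)"
    using \<open>\<tau> > 0\<close> \<open>h > 0\<close> v
    by (intro implicit_step_energy fin) (auto simp: hh_proj_support grid_div_hh_proj fin)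
  also have "\<dots> = (\<Sum>x\<in>?K. ?u x \<bullet> v x) + \<tau> * (\<Sum>x\<in>?K. F x \<bullet> v x)"
    using step by (simp add: inner_add_left sum.distrib sum_distrib_left)
  also have "\<dots> \<le> ?N w * ?N v + \<tau> * (?N F * ?N v)"
  proof (intro add_mono mult_left_mono sum_inner_le_L2_set)
    have "(\<Sum>x\<in>?K. ?u x \<bullet> v x) \<le> ?N ?u * ?N v"
      by (rule sum_inner_le_L2_set)
    also have "\<dots> \<le> ?N w * ?N v"
      using L2_set_hh_proj_le[OF fin] \<open>h > 0\<close> by (intro mult_right_mono L2_set_nonneg) auto
    finally show "(\<Sum>x\<in>?K. ?u x \<bullet> v x) \<le> ?N w * ?N v" .
  qed (use \<open>\<tau> > 0\<close> in simp)
  finally have "((1 + 3 * a * \<tau>) * ?N v) * ?N v \<le> (?N w + \<tau> * ?N F) * ?N v"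
    by (simp add: power2_eq_square algebra_simps)
  then have "(1 + 3 * a * \<tau>) * ?N v \<le> ?N w + \<tau> * ?N F"
  proof (cases "?N v = 0")
    case True
    then show ?thesis
      using \<open>\<tau> > 0\<close> by (simp add: L2_set_nonneg)
  next
    case False
    then have "?N v > 0"
      by (simp add: less_le L2_set_nonneg)
    then show ?thesis
      using \<open>_ * ?N v \<le> _\<close> by (simp add: mult_le_cancel_right)
  qed
  \<comment> \<open>The factor \<open>sqrt (h ^ 3)\<close> turns the unweighted interior norms back
    into grid norms.\<close>
  then have "sqrt (h ^ 3) * ((1 + 3 * a * \<tau>) * ?N v) \<le> sqrt (h ^ 3) * (?N w + \<tau> * ?N F)"
    using \<open>h > 0\<close> by (intro mult_left_mono) auto
  also have "\<dots> = grid_norm \<Omega> h w + \<tau> * (sqrt (h ^ 3) * ?N F)"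
    using grid_norm_eq_L2_set[of \<Omega> h w] fin \<open>h > 0\<close> w by (simp add: algebra_simps)
  also have "\<dots> \<le> grid_norm \<Omega> h w + \<tau> * grid_norm \<Omega> h F"
    using L2_set_le_grid_norm[OF fin \<open>h > 0\<close>] \<open>\<tau> > 0\<close> by (intro add_left_mono mult_left_mono) auto
  finally show ?thesis
    using grid_norm_eq_L2_set[of \<Omega> h v] fin \<open>h > 0\<close> v by (simp add: a_def algebra_simps)
qed

section \<open>Scalar estimates for the iterated implicit step\<close>

text \<open>On the right, the factor after \<open>1 - p\<close> is the coefficient of \<alpha> in
  \<open>R0\<close>. Squaring and cancelling \<open>1 - p\<close> reduces the claim to
  \<open>(1 + p) * (1 - e) \<le> 3 * ((1 - p) * (1 + e))\<close>.\<close>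

lemma implicit_euler_decay_factor:
  fixes a p :: real
  assumes "a > 0" "0 \<le> p" "p \<le> 1 / (1 + 3 * a)"
  shows "sqrt ((1 - p\<^sup>2) / (2 * (3 * a)))
    \<le> (1 - p) * (1 / (1 - exp (- a)) * sqrt ((1 - (exp (- a))\<^sup>2) / (2 * a)))"
proof -
  define e where "e = exp (- a)"
  have e: "0 < e" "e < 1" "1 - e \<le> a"
    using assms(1) exp_ge_add_one_self[of "- a"] by (auto simp: e_def)
  have p1: "p * (1 + 3 * a) \<le> 1"
    using assms by (simp add: field_simps)
  have "p < 1"
    using assms by (intro le_less_trans[OF assms(3)]) (simp add: divide_less_eq)
  have "(1 + p) * (1 - e) \<le> 3 * ((1 - p) * (1 + e))"
  proof -
    \<comment> \<open>Multiplication by \<open>1 + 3 * a\<close> lets \<open>p1\<close> eliminate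
      \<open>p\<close> on both sides. What remains is \<open>5 * a \<le> 9 * a\<close>, by
      \<open>1 - e \<le> a\<close>.\<close>
    have "(1 + p) * (1 - e) * (1 + 3 * a) \<le> (2 + 3 * a) * (1 - e)"
      using mult_right_mono[OF p1, of "1 - e"] e by (simp add: algebra_simps)
    also have "\<dots> = 2 * (1 - e) + 3 * a - 3 * (a * e)"
      by (simp add: algebra_simps)
    also have "\<dots> \<le> 2 * a + 3 * a"
      using e assms(1) by - (rule order_trans[of _ "2 * (1 - e) + 3 * a"], simp_all)
    also have "\<dots> \<le> 3 * (3 * a)"
      using assms(1) by simp
    also have "\<dots> \<le> 3 * ((1 - p) * (1 + 3 * a))"
      using p1 by (simp add: algebra_simps)
    also have "\<dots> \<le> 3 * ((1 - p) * (1 + e)) * (1 + 3 * a)"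
      using e assms(1) \<open>p < 1\<close> by simp
    finally show ?thesis
      using assms(1) by (simp add: mult_le_cancel_right)
  qed
  then have "(1 + p) * (1 - e) / (6 * a) \<le> 3 * ((1 - p) * (1 + e)) / (6 * a)"
    using assms(1) by (intro divide_right_mono) auto
  then have "(1 + p) / (2 * (3 * a)) \<le> (1 - p) * (1 + e) / ((1 - e) * (2 * a))"
    using assms(1) e by (simp add: field_simps)
  then have "(1 - p) * ((1 + p) / (2 * (3 * a))) \<le> (1 - p) * ((1 - p) * (1 + e) / ((1 - e) * (2 * a)))"
    using \<open>p < 1\<close> by (intro mult_left_mono) auto
  also have "\<dots> = ((1 - p) * (1 / (1 - e)))\<^sup>2 * ((1 - e\<^sup>2) / (2 * a))"
    using e assms(1) by (simp add: divide_simps power2_eq_square) (simp add: algebra_simps)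
  finally have "(1 - p\<^sup>2) / (2 * (3 * a)) \<le> ((1 - p) * (1 / (1 - e)))\<^sup>2 * ((1 - e\<^sup>2) / (2 * a))"
    by (simp add: power2_eq_square algebra_simps)
  then have "sqrt ((1 - p\<^sup>2) / (2 * (3 * a))) \<le> sqrt (((1 - p) * (1 / (1 - e)))\<^sup>2 * ((1 - e\<^sup>2) / (2 * a)))"
    by (rule real_sqrt_le_mono)
  also have "\<dots> = (1 - p) * (1 / (1 - e)) * sqrt ((1 - e\<^sup>2) / (2 * a))"
    unfolding real_sqrt_mult real_sqrt_abs using e \<open>p < 1\<close> by simp
  finally show ?thesis
    by (simp only: e_def mult.assoc)
qed

text \<open>Discrete Duhamel formula over \<open>T\<close> steps. Cauchy-Schwarz separates the
  forcing from the damping weights, whose squares form a geometric sum; Bernoulli's inequality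
  bounds \<open>p\<close> independently of \<tau>.\<close>

lemma implicit_euler_recursion:
  fixes N F :: "nat \<Rightarrow> real"
  assumes c: "c > 0" and T: "T \<ge> 1" "\<tau> = 1 / real T"
    and rec: "\<And>k. k < T \<Longrightarrow> (1 + c * \<tau>) * N (Suc k) \<le> N k + \<tau> * F k"
    and F: "(\<Sum>k<T. \<tau> * (F k)\<^sup>2) \<le> \<alpha>\<^sup>2" "\<alpha> \<ge> 0"
  defines "p \<equiv> (1 / (1 + c * \<tau>)) ^ T"
  shows "N T \<le> p * N 0 + sqrt ((1 - p\<^sup>2) / (2 * c)) * \<alpha>"
    and "0 \<le> p" "p \<le> 1 / (1 + c)"
proof -
  have \<tau>: "\<tau> > 0" using T by simp
  define q where "q = 1 / (1 + c * \<tau>)"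
  have q: "q > 0" "q * (1 + c * \<tau>) = 1"
    using c \<tau> by (auto simp: q_def add_pos_pos less_imp_neq[symmetric])
  \<comment> \<open>The exponents are at least 1: forcing that enters in step \<open>i\<close> is
    already damped in that step.\<close>
  define G where "G k = (\<Sum>i<k. q ^ (k - i) * F i)" for k
  define S where "S k = (\<Sum>i<k. (q ^ (k - i))\<^sup>2)" for k
  have G_Suc: "G (Suc k) = q * (G k + F k)" for k
    by (simp add: G_def sum_distrib_left distrib_left Suc_diff_le mult.assoc)
  have S_Suc: "S (Suc k) = q\<^sup>2 * (S k + 1)" for k
    by (simp add: S_def sum_distrib_left distrib_left Suc_diff_le power_mult_distrib)
  have N: "N k \<le> q ^ k * N 0 + \<tau> * G k" if "k \<le> T" for k
    using that
  proof (induction k)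
    case (Suc k)
    have "N (Suc k) = q * ((1 + c * \<tau>) * N (Suc k))"
      using q(2) by (simp flip: mult.assoc)
    also have "\<dots> \<le> q * (N k + \<tau> * F k)"
      using rec[of k] Suc.prems q(1) by (intro mult_left_mono) auto
    also have "\<dots> \<le> q * (q ^ k * N 0 + \<tau> * G k + \<tau> * F k)"
      using Suc q(1) by (intro mult_left_mono) auto
    also have "\<dots> = q ^ Suc k * N 0 + \<tau> * G (Suc k)"
      by (simp add: G_Suc algebra_simps)
    finally show ?case .
  qed (simp add: G_def)
  \<comment> \<open>Closed form of the geometric sum, written without division.\<close>
  have "((1 + c * \<tau>)\<^sup>2 - 1) * S k = 1 - (q ^ k)\<^sup>2" for k
  proof (induction k)
    case (Suc k)
    have "q\<^sup>2 * (1 + c * \<tau>)\<^sup>2 = 1"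
      using q(2) by (simp flip: power_mult_distrib)
    have "((1 + c * \<tau>)\<^sup>2 - 1) * S (Suc k) = q\<^sup>2 * (((1 + c * \<tau>)\<^sup>2 - 1) * S k) + q\<^sup>2 * (1 + c * \<tau>)\<^sup>2 - q\<^sup>2"
      by (simp add: S_Suc algebra_simps)
    also have "\<dots> = 1 - (q ^ Suc k)\<^sup>2"
      unfolding Suc.IH \<open>q\<^sup>2 * (1 + c * \<tau>)\<^sup>2 = 1\<close> by (simp add: algebra_simps power_mult_distrib)
    finally show ?case .
  qed (simp add: S_def)
  \<comment> \<open>Expanding the square leaves \<open>2 * c * \<tau>\<close> and a nonnegative
    quadratic term; dropping the latter gives the bound on \<open>\<tau> * S T\<close>.\<close>
  from this[of T] have S_eq: "2 * c * (\<tau> * S T) + (c * \<tau>)\<^sup>2 * S T = 1 - p\<^sup>2"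
    by (simp add: p_def q_def power2_sum algebra_simps)
  have "(c * \<tau>)\<^sup>2 * S T \<ge> 0"
    by (simp add: S_def sum_nonneg)
  then have S_le: "\<tau> * S T \<le> (1 - p\<^sup>2) / (2 * c)"
    using S_eq c by (simp add: field_simps)
  have "\<tau> * G T \<le> sqrt ((1 - p\<^sup>2) / (2 * c)) * \<alpha>"
  proof -
    have "(G T)\<^sup>2 \<le> S T * (\<Sum>i<T. (F i)\<^sup>2)"
      unfolding G_def S_def by (rule Cauchy_Schwarz_ineq_sum)
    then have "(\<tau> * G T)\<^sup>2 \<le> (\<tau> * S T) * (\<Sum>i<T. \<tau> * (F i)\<^sup>2)"
      using \<tau> by (simp add: power_mult_distrib power2_eq_square flip: sum_distrib_left)
    also have "\<dots> \<le> ((1 - p\<^sup>2) / (2 * c)) * \<alpha>\<^sup>2"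
      using \<tau> F(1) S_le
      by (intro mult_mono sum_nonneg mult_nonneg_nonneg)
        (auto simp: S_def sum_nonneg intro: order_trans[OF _ S_le])
    finally have "\<bar>\<tau> * G T\<bar> \<le> sqrt ((1 - p\<^sup>2) / (2 * c) * \<alpha>\<^sup>2)"
      by (rule real_le_rsqrt[of "\<bar>\<tau> * G T\<bar>", simplified])
    also have "\<dots> = sqrt ((1 - p\<^sup>2) / (2 * c)) * \<alpha>"
      using F(2) by (simp only: real_sqrt_mult) simp
    finally show ?thesis by simp
  qed
  then show "N T \<le> p * N 0 + sqrt ((1 - p\<^sup>2) / (2 * c)) * \<alpha>"
    using N[of T] by (simp add: p_def q_def)
  show "0 \<le> p"
    using q(1) by (simp add: p_def q_def)
  \<comment> \<open>\<open>T\<close> steps of size \<open>c * \<tau>\<close> add up to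
    \<open>c\<close>, so Bernoulli applies without any loss depending on \<tau>.\<close>
  have "1 + c = 1 + real T * (c * \<tau>)"
    using T by simp
  also have "\<dots> \<le> (1 + c * \<tau>) ^ T"
    using c \<tau> by (intro Bernoulli_inequality) (simp add: order_trans[of _ 0])
  finally show "p \<le> 1 / (1 + c)"
    using c by (simp add: p_def power_divide frac_le)
qed

theorem theorem2p14:
  fixes \<Omega> :: "(real^3) set" and f :: "real \<Rightarrow> real^3 \<Rightarrow> real^3"
    and A :: "real \<Rightarrow> real" and \<alpha> \<tau> h R :: real and T1 :: nat
  assumes "lipschitz_domain \<Omega>"
    and "poincare_const A"
    and "L2loc_L2 \<Omega> f"
    and "\<alpha> \<ge> 0"
    and "\<And>n::nat. n \<ge> 1 \<Longrightarrow> L2_L2_norm (real n - 1) (real n) \<Omega> f \<le> \<alpha>"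
    and "T1 \<ge> 1" and "\<tau> = 1 / real T1"
    and "admissible_mesh \<Omega> h"
    and "R \<ge> R0 (A (diameter \<Omega>)) \<alpha>"
  shows "\<forall>v0 \<in> U_ball \<Omega> h R.
           (\<exists>!v. dNS_solution \<Omega> h \<tau> f v0 v) \<and>
           (\<forall>v. dNS_solution \<Omega> h \<tau> f v0 v \<longrightarrow> (\<forall>m. v (m * T1) \<in> U_ball \<Omega> h R))"
proof (intro ballI conjI allI impI)
  have h: "h > 0" and \<tau>: "\<tau> > 0"
    using assms by (simp_all add: admissible_mesh_def)
  have \<Omega>: "bounded \<Omega>" "open \<Omega>"
    using assms(1) by (simp_all add: lipschitz_domain_def)
  note fin = finite_grid_dom[OF \<Omega>(1) h]
  fix v0
  assume v0: "v0 \<in> U_ball \<Omega> h R"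
  then show "\<exists>!v. dNS_solution \<Omega> h \<tau> f v0 v"
    using fin h \<tau> by (intro dNS_solution_ex1) (auto simp: U_ball_def)
  fix v m
  assume "dNS_solution \<Omega> h \<tau> f v0 v"
  then have v: "v 0 = v0" "\<And>n x. x \<notin> dom_int \<Omega> h \<Longrightarrow> v (Suc n) x = 0"
    "\<And>n x. x \<in> dom_int \<Omega> h \<Longrightarrow> implicit_step h \<tau> (hh_proj \<Omega> h (v n)) (v (Suc n)) x
         = hh_proj \<Omega> h (v n) x + \<tau> *\<^sub>R cell_avg h \<tau> f n x"
    using \<tau> by (auto simp: dNS_solution_iff)
  \<comment> \<open>For \<open>n = 0\<close> the boundary values vanish because the datum lies in
    \<open>U_ball\<close>; later they vanish by the scheme.\<close>
  have supp: "v n x = 0" if "x \<notin> dom_int \<Omega> h" for n x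
    using v(1,2) v0 that by (cases n) (auto simp: U_ball_def grid_fun_def)
  define a where "a = 1 / (A (diameter \<Omega>))\<^sup>2"
  have "A (diameter \<Omega>) > 0"
    using assms(1,2) unfolding poincare_const_def by blast
  then have a: "a > 0" "A (diameter \<Omega>) powi (-2) = a"
    by (simp_all add: a_def power_int_minus divide_inverse)
  have "grid_norm \<Omega> h (v (m * T1)) \<le> R"
  proof (induction m)
    case 0
    then show ?case
      using v0 v(1) by (simp add: U_ball_def)
  next
    case (Suc m)
    \<comment> \<open>\<open>k\<close> counts the steps inside the unit time interval that starts at
      time \<open>m\<close>.\<close>
    define N where "N k = grid_norm \<Omega> h (v (m * T1 + k))" for k
    define F where "F k = grid_norm \<Omega> h (cell_avg h \<tau> f (m * T1 + k))" for k
    define p where "p = (1 / (1 + 3 * a * \<tau>)) ^ T1"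
    have rec: "(1 + 3 * a * \<tau>) * N (Suc k) \<le> N k + \<tau> * F k" for k
      unfolding N_def F_def a_def using assms(1,2,8) fin h \<tau> supp v(3)
      by (intro implicit_step_decay) auto
    have F: "(\<Sum>k<T1. \<tau> * (F k)\<^sup>2) \<le> \<alpha>\<^sup>2"
    proof -
      have "(F k)\<^sup>2 = (\<Sum>x\<in>grid_dom \<Omega> h. (norm (cell_avg h \<tau> f (m * T1 + k) x))\<^sup>2 * h ^ 3)" for k
        unfolding F_def grid_norm_def using h by (intro real_sqrt_pow2 sum_nonneg) auto
      then have "(\<Sum>k<T1. \<tau> * (F k)\<^sup>2) \<le> (L2_L2_norm (real m) (real m + 1) \<Omega> f)\<^sup>2"
        using sum_cell_avg_le[OF fin \<Omega>(2) h assms(3,6,7), of m] by simp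
      also have "\<dots> \<le> \<alpha>\<^sup>2"
      proof (rule power_mono)
        show "L2_L2_norm (real m) (real m + 1) \<Omega> f \<le> \<alpha>"
          \<comment> \<open>The hypothesis on the forcing counts unit intervals by their right end
            point.\<close>
          using assms(5)[of "Suc m"] by (simp add: add.commute)
        show "0 \<le> L2_L2_norm (real m) (real m + 1) \<Omega> f"
          by (auto simp: L2_L2_norm_def set_lebesgue_integral_def intro!: integral_nonneg_AE)
      qed
      finally show ?thesis .
    qed
    have "3 * a > 0"
      using a by simp
    note bnd = implicit_euler_recursion[OF this assms(6,7) rec F assms(4), folded p_def]
    have "N T1 \<le> p * N 0 + sqrt ((1 - p\<^sup>2) / (2 * (3 * a))) * \<alpha>"
      by (rule bnd(1))
    \<comment> \<open>The damped starting value is charged to the share \<open>p * R\<close>. The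
      forcing term is at most \<open>(1 - p)\<close> times \<open>R0\<close>, hence fits into the
      remaining share of \<open>R\<close>.\<close>
    also have "\<dots> \<le> p * R + (1 - p) * R"
    proof (rule add_mono)
      show "p * N 0 \<le> p * R"
        using Suc bnd(2) by (intro mult_left_mono) (simp_all add: N_def)
      have "p \<le> 1"
        using bnd(3) a(1) by (simp add: field_simps) (smt (verit) mult_nonneg_nonneg bnd(2))
      have "sqrt ((1 - p\<^sup>2) / (2 * (3 * a))) * \<alpha> \<le>
          (1 - p) * (1 / (1 - exp (- a)) * sqrt ((1 - (exp (- a))\<^sup>2) / (2 * a))) * \<alpha>"
        using implicit_euler_decay_factor[OF a(1) bnd(2,3)] assms(4) by (rule mult_right_mono)
      also have "\<dots> = (1 - p) * R0 (A (diameter \<Omega>)) \<alpha>"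
        by (simp add: R0_def a(2) mult.assoc flip: exp_double)
      also have "\<dots> \<le> (1 - p) * R"
        using assms(9) \<open>p \<le> 1\<close> by (intro mult_left_mono) auto
      finally show "sqrt ((1 - p\<^sup>2) / (2 * (3 * a))) * \<alpha> \<le> (1 - p) * R" .
    qed
    finally show ?case
      by (simp add: N_def algebra_simps)
  qed
  then show "v (m * T1) \<in> U_ball \<Omega> h R"
    using supp by (auto simp: U_ball_def grid_fun_def)
qed

end
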